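(* If $\mathcal T_h$ is quasi-uniform, then the two-level overlapping Schwarz preconditioner $$B_1^{-1}=\sum_{j=1}^N\Pi_{j,1}A_{j,1}^{-1}\Pi_{j,1}^*+\Pi_{0,1}A_{0,1}^{-1}\Pi_{0,1}^*$$ satisfies $$\kappa(B_1^{-1}A_{h,1})\le C,$$ where $\kappa$ is the condition number and the positive constant $C$ depends only on $\Lambda$ and $M$.
   Context: Problem. $\Omega$ is a bounded convex polyhedral region, $\rho\in L^\infty(\Omega)$ is a positive function (possibly highly heterogeneous with very high contrast), and $a^{(1)}(u,v)=\int_\Omega\rho\,\nabla u\cdot\nabla v\,dx$ on $H_0^1(\Omega)$. $\mathcal T_h$ is a simplicial partition of $\Omega$ with node set $\mathcal X_h$, $V_{h,1}$ is the space of continuous piecewise linear functions on $\mathcal T_h$ vanishing on $\partial\Omega$, and, with $(\cdot,\cdot)$ the inner product on $V_{h,1}$, $A_{h,1}:V_{h,1}\to V_{h,1}$ is the operator given by $(A_{h,1}u,v)=a^{(1)}(u,v)$ for all $u,v\in V_{h,1}$. Subdomains. $\bar\Omega=\bigcup_{i=1}^N\bar\Omega_i$ is a decomposition into nonoverlapping subdomains; the overlapping subdomain $\Omega_i'$ is obtained by extending $\Omega_i$ by several layers of elements of $\mathcal T_h$. $\mathcal S^{(i)}=\{1\le j\le N:\Omega_j'\cap\Omega_i'\neq\emptyset\}$ and $M=\max_{1\le i\le N}|\mathcal S^{(i)}|$. $\theta_i$ is the continuous piecewise linear function on $\mathcal T_h$ whose value at $x\in\mathcal X_h$ is $\theta_i(x)=1/|\mathcal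 N_x|$ if $x\in\Omega_i'$ or $x\in\partial\Omega_i'\cap\partial\Omega$, and $\theta_i(x)=0$ otherwise, where $\mathcal N_x=\{j:x\in\Omega_j'\text{ or }x\in\partial\Omega_j'\cap\partial\Omega\}$; the $\theta_i$ form a partition of unity. Coarse space. $V_{h,1}(\bar\Omega_i)=V_{h,1}|_{\bar\Omega_i}$, $n_i=\dim V_{h,1}(\bar\Omega_i)$, $a_i^{(1)}(u,w)=\int_{\Omega_i}\rho\,\nabla u\cdot\nabla w\,dx$, and $s_i^{(1)}(u,w)=\int_{\Omega_i}\rho\sum_{l\in\mathcal S^{(i)}}|\nabla\theta_l|^2\,u\,w\,dx$. On each $\Omega_i$ consider the generalized eigenproblem: find $\lambda_j^{(i)}$ and $\phi_j^{(i)}\in V_{h,1}(\bar\Omega_i)$ with $$s_i^{(1)}(\phi_j^{(i)},w)=\lambda_j^{(i)}a_i^{(1)}(\phi_j^{(i)},w)\quad\forall w\in V_{h,1}(\bar\Omega_i),\qquad j=1,\dots,n_i.$$ The eigenvalues are taken to be positive real numbers, arranged as $\lambda_1^{(i)}\ge\cdots\ge\lambda_{l_i}^{(i)}\ge\Lambda>\lambda_{l_i+1}^{(i)}\ge\cdots\ge\lambda_{n_i}^{(i)}>0$, where $\Lambda>1$ is a user-defined threshold and $l_i$ is a nonnegative integer; the eigenfunctions are chosen so that $s_i^{(1)}(\phi_j^{(i)},\phi_l^{(i)})=0=a_i^{(1)}(\phi_j^{(i)},\phi_l^{(i)})$ for $j\ne l$ and $s_i^{(1)}(\phi_j^{(i)},\phi_j^{(i)})=1$.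 Set $V_{aux}^{(i)}=\mathrm{span}\{\phi_1^{(i)},\dots,\phi_{l_i}^{(i)}\}$, $\tilde V=\{v\in V_{h,1}:s_i^{(1)}(v,w)=0\ \ \forall w\in V_{aux}^{(i)},\ i=1,\dots,N\}$, and let $V_{0,1}$ be the $a^{(1)}$-orthogonal complement of $\tilde V$ in $V_{h,1}$. Operators. $V_{h,1}(\Omega_j')=\{u\in V_{h,1}:\mathrm{supp}(u)\subseteq\Omega_j'\}$; $A_{j,1}$ on $V_{h,1}(\Omega_j')$ is given by $(A_{j,1}u,v)=\int_{\Omega_j'}\rho\,\nabla u\cdot\nabla v\,dx$; $A_{0,1}$ on $V_{0,1}$ is given by $(A_{0,1}u,v)=a^{(1)}(u,v)$; $\Pi_{j,1}:V_{h,1}(\Omega_j')\to V_{h,1}$ ($j=1,\dots,N$) and $\Pi_{0,1}:V_{0,1}\to V_{h,1}$ are the inclusions, with adjoints $\Pi_{j,1}^*$ and $\Pi_{0,1}^*$. *)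

theory Defs
  imports "HOL-Analysis.Analysis" "HOL-Library.Function_Algebras"
begin

section \<open>Real functions as a vector space\<close>

interpretation fun_space: vector_space "\<lambda>(c::real) (f::'a \<Rightarrow> real) x. c * f x"
  by unfold_locales (simp_all add: fun_eq_iff distrib_left distrib_right)

text \<open>
  For a continuous piecewise linear function this pointwise gradient exists off the faces of the
  mesh, a null set, and is the weak gradient there. Its (arbitrary) values on the faces do not
  affect any integral.
\<close>
definition grad :: "('a::real_inner \<Rightarrow> real) \<Rightarrow> 'a \<Rightarrow> 'a" where
  "grad u x = (THE D. GDERIV u x :> D)"

section \<open>Meshes and finite element spaces\<close>

definition simplicial_partition :: "'a::euclidean_space set \<Rightarrow> 'a set set \<Rightarrow> bool" where
  "simplicial_partition \<Omega> \<T> \<longleftrightarrow>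
     triangulation \<T> \<and> (\<forall>T\<in>\<T>. int DIM('a) simplex T) \<and> \<Union>\<T> = closure \<Omega>"

definition mesh_nodes :: "'a::euclidean_space set set \<Rightarrow> 'a set" where
  "mesh_nodes \<T> = (\<Union>T\<in>\<T>. {x. x extreme_point_of T})"

text \<open>
  Quasi-uniformity is a property of a family of meshes: the inradius of every simplex of a mesh is
  at least a fixed multiple of the mesh size. The constant \<open>\<sigma>\<close> is common to all meshes of the
  family; shape regularity is included.
\<close>
definition quasi_uniform :: "'a::euclidean_space set set set \<Rightarrow> bool" where
  "quasi_uniform \<F> \<longleftrightarrow>
     (\<exists>\<sigma>>0. \<forall>\<T>\<in>\<F>. \<forall>T\<in>\<T>. \<exists>c r. ball c r \<subseteq> T \<and> \<sigma> * Max (diameter ` \<T>) \<le> r)"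

text \<open>Functions on \<open>\<Union>\<T>\<close> are extended by zero, so that they are determined by their values there.\<close>
definition pw_linear :: "'a::euclidean_space set set \<Rightarrow> ('a \<Rightarrow> real) set" where
  "pw_linear \<T> = {u. continuous_on (\<Union>\<T>) u \<and>
                     (\<forall>T\<in>\<T>. \<exists>g c. \<forall>x\<in>T. u x = inner g x + c) \<and>
                     (\<forall>x. x \<notin> \<Union>\<T> \<longrightarrow> u x = 0)}"

definition fe_space :: "'a::euclidean_space set \<Rightarrow> 'a set set \<Rightarrow> ('a \<Rightarrow> real) set" where
  "fe_space \<Omega> \<T> = {u \<in> pw_linear \<T>. \<forall>x\<in>frontier \<Omega>. u x = 0}"

definition add_layer :: "'a::topological_space set set \<Rightarrow> 'a set \<Rightarrow> 'a set" where
  "add_layer \<T> K = \<Union>{T \<in> \<T>. T \<inter> K \<noteq> {}}"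

definition extend_by_layers :: "'a::topological_space set set \<Rightarrow> nat \<Rightarrow> 'a set \<Rightarrow> 'a set" where
  "extend_by_layers \<T> k U = interior ((add_layer \<T> ^^ k) (closure U))"

section \<open>Operators on finite-dimensional spaces of functions\<close>

text \<open>The element of \<open>W\<close> that represents the functional \<open>F\<close> with respect to \<open>ip\<close>.\<close>
definition riesz_rep :: "('v \<Rightarrow> 'v \<Rightarrow> real) \<Rightarrow> 'v set \<Rightarrow> ('v \<Rightarrow> real) \<Rightarrow> 'v" where
  "riesz_rep ip W F = (THE w. w \<in> W \<and> (\<forall>v\<in>W. ip w v = F v))"

definition form_operator ::
  "('v \<Rightarrow> 'v \<Rightarrow> real) \<Rightarrow> 'v set \<Rightarrow> ('v \<Rightarrow> 'v \<Rightarrow> real) \<Rightarrow> 'v \<Rightarrow> 'v" where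
  "form_operator ip W b u = riesz_rep ip W (b u)"

definition adjoint_into ::
  "('v \<Rightarrow> 'v \<Rightarrow> real) \<Rightarrow> 'v set \<Rightarrow> ('v \<Rightarrow> 'v) \<Rightarrow> 'v \<Rightarrow> 'v" where
  "adjoint_into ip W P u = riesz_rep ip W (\<lambda>v. ip u (P v))"

text \<open>The summand \<open>\<Pi> A\<^sup>-\<^sup>1 \<Pi>*\<close> of a Schwarz preconditioner, \<open>A\<close> acting on the subspace \<open>W\<close>;
  the inclusion \<open>\<Pi>\<close> is the identity on \<open>W\<close>.\<close>
definition subspace_correction ::
  "('v \<Rightarrow> 'v \<Rightarrow> real) \<Rightarrow> 'v set \<Rightarrow> ('v \<Rightarrow> 'v) \<Rightarrow> 'v \<Rightarrow> 'v" where
  "subspace_correction ip W A u = id (inv_into W A (adjoint_into ip W id u))"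

definition eigenvalues_on ::
  "('a \<Rightarrow> real) set \<Rightarrow> (('a \<Rightarrow> real) \<Rightarrow> ('a \<Rightarrow> real)) \<Rightarrow> real set" where
  "eigenvalues_on V A = {\<mu>. \<exists>u\<in>V. u \<noteq> 0 \<and> A u = (\<lambda>x. \<mu> * u x)}"

text \<open>
  Spectral condition number of an operator that is self-adjoint for some inner product on the
  finite-dimensional space \<open>V\<close>: the quotient of the largest and the smallest absolute value of an
  eigenvalue, infinite for a singular operator. On the zero space the quotient evaluates to 0.
\<close>
definition cond_number ::
  "('a \<Rightarrow> real) set \<Rightarrow> (('a \<Rightarrow> real) \<Rightarrow> ('a \<Rightarrow> real)) \<Rightarrow> ereal" where
  "cond_number V A =
     (if 0 \<in> eigenvalues_on V A then \<infinity>
      else (SUP \<mu>\<in>eigenvalues_on V A. ereal \<bar>\<mu>\<bar>) / (INF \<mu>\<in>eigenvalues_on V A. ereal \<bar>\<mu>\<bar>))"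

section \<open>Overlapping decompositions\<close>

text \<open>
  The subdomains are indexed by \<open>{1..N}\<close>, and \<open>Osub i\<close> is extended by \<open>k i\<close> layers of elements.
\<close>
locale overlapping_decomposition =
  fixes \<Omega> :: "'a::euclidean_space set"
    and \<rho> :: "'a \<Rightarrow> real"
    and \<T> :: "'a set set"
    and N :: nat
    and Osub :: "nat \<Rightarrow> 'a set"
    and k :: "nat \<Rightarrow> nat"
  assumes domain: "open \<Omega>" "\<Omega> \<noteq> {}" "bounded \<Omega>" "convex \<Omega>" "polyhedron (closure \<Omega>)"
    and coeff_measurable: "\<rho> \<in> borel_measurable (lebesgue_on \<Omega>)"
    and coeff_bounded: "\<exists>K. AE x in lebesgue_on \<Omega>. \<rho> x \<le> K"
    and coeff_pos: "AE x in lebesgue_on \<Omega>. 0 < \<rho> x"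
    and mesh: "simplicial_partition \<Omega> \<T>"
    and subdomain: "\<And>i. i \<in> {1..N} \<Longrightarrow> \<exists>\<D>\<subseteq>\<T>. \<D> \<noteq> {} \<and> Osub i = interior (\<Union>\<D>)"
    and nonoverlapping: "\<And>i j. \<lbrakk>i \<in> {1..N}; j \<in> {1..N}; i \<noteq> j\<rbrakk> \<Longrightarrow> Osub i \<inter> Osub j = {}"
    and covering: "closure \<Omega> = (\<Union>i\<in>{1..N}. closure (Osub i))"
    and layers: "\<And>i. i \<in> {1..N} \<Longrightarrow> 1 \<le> k i"
begin

definition Vh :: "('a \<Rightarrow> real) set" where
  "Vh = fe_space \<Omega> \<T>"

definition form_on :: "'a set \<Rightarrow> ('a \<Rightarrow> real) \<Rightarrow> ('a \<Rightarrow> real) \<Rightarrow> real" where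
  "form_on U u v = (LINT x|lebesgue_on U. \<rho> x * inner (grad u x) (grad v x))"

definition a :: "('a \<Rightarrow> real) \<Rightarrow> ('a \<Rightarrow> real) \<Rightarrow> real" where
  "a = form_on \<Omega>"

definition Oext :: "nat \<Rightarrow> 'a set" where
  "Oext i = extend_by_layers \<T> (k i) (Osub i)"

definition neighbours :: "nat \<Rightarrow> nat set" where
  "neighbours i = {j \<in> {1..N}. Oext j \<inter> Oext i \<noteq> {}}"

definition overlap_number :: nat where
  "overlap_number = Max ((\<lambda>i. card (neighbours i)) ` {1..N})"

definition node_in :: "'a \<Rightarrow> nat \<Rightarrow> bool" where
  "node_in x i \<longleftrightarrow> x \<in> Oext i \<or> x \<in> frontier (Oext i) \<inter> frontier \<Omega>"

definition theta :: "nat \<Rightarrow> 'a \<Rightarrow> real" where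
  "theta i = (THE u. u \<in> pw_linear \<T> \<and>
     (\<forall>x\<in>mesh_nodes \<T>. u x = (if node_in x i then 1 / real (card {j \<in> {1..N}. node_in x j}) else 0)))"

definition Vsub :: "nat \<Rightarrow> ('a \<Rightarrow> real) set" where
  "Vsub i = (\<lambda>u x. if x \<in> closure (Osub i) then u x else 0) ` Vh"

definition n_sub :: "nat \<Rightarrow> nat" where
  "n_sub i = fun_space.dim (Vsub i)"

definition a_sub :: "nat \<Rightarrow> ('a \<Rightarrow> real) \<Rightarrow> ('a \<Rightarrow> real) \<Rightarrow> real" where
  "a_sub i = form_on (Osub i)"

definition s_sub :: "nat \<Rightarrow> ('a \<Rightarrow> real) \<Rightarrow> ('a \<Rightarrow> real) \<Rightarrow> real" where
  "s_sub i u w =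
     (LINT x|lebesgue_on (Osub i). \<rho> x * (\<Sum>l\<in>neighbours i. (norm (grad (theta l) x))\<^sup>2) * u x * w x)"

text \<open>
  The extended subdomains are open, so the (closed) support is compared with their closures; for
  functions in \<open>Vh\<close> this says that the function vanishes outside \<open>Oext j\<close>.
\<close>
definition Vloc :: "nat \<Rightarrow> ('a \<Rightarrow> real) set" where
  "Vloc j = {u \<in> Vh. closure {x. u x \<noteq> 0} \<subseteq> closure (Oext j)}"

end

section \<open>The two-level method\<close>

text \<open>
  \<open>ip\<close> is the inner product on the finite element space, \<open>ev i j\<close> and \<open>\<phi> i j\<close> are the eigenpairs
  on the \<open>i\<close>-th subdomain (\<open>1 \<le> j \<le> n_sub i\<close>), and the first \<open>l i\<close> of them are selected.
\<close>
locale two_level_schwarz = overlapping_decomposition \<Omega> \<rho> \<T> N Osub k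
  for \<Omega> :: "'a::euclidean_space set" and \<rho> \<T> N Osub k +
  fixes ip :: "('a \<Rightarrow> real) \<Rightarrow> ('a \<Rightarrow> real) \<Rightarrow> real"
    and \<Lambda> :: real
    and ev :: "nat \<Rightarrow> nat \<Rightarrow> real"
    and \<phi> :: "nat \<Rightarrow> nat \<Rightarrow> 'a \<Rightarrow> real"
    and l :: "nat \<Rightarrow> nat"
  assumes ip_sym: "\<And>u v. \<lbrakk>u \<in> Vh; v \<in> Vh\<rbrakk> \<Longrightarrow> ip u v = ip v u"
    and ip_add: "\<And>u v w. \<lbrakk>u \<in> Vh; v \<in> Vh; w \<in> Vh\<rbrakk> \<Longrightarrow> ip (u + v) w = ip u w + ip v w"
    and ip_scale: "\<And>c u v. \<lbrakk>u \<in> Vh; v \<in> Vh\<rbrakk> \<Longrightarrow> ip (\<lambda>x. c * u x) v = c * ip u v"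
    and ip_pos: "\<And>u. \<lbrakk>u \<in> Vh; u \<noteq> 0\<rbrakk> \<Longrightarrow> 0 < ip u u"
    and threshold: "1 < \<Lambda>"
    and eigenfunction: "\<And>i j. \<lbrakk>i \<in> {1..N}; j \<in> {1..n_sub i}\<rbrakk> \<Longrightarrow> \<phi> i j \<in> Vsub i"
    and eigenpair: "\<And>i j w. \<lbrakk>i \<in> {1..N}; j \<in> {1..n_sub i}; w \<in> Vsub i\<rbrakk>
                      \<Longrightarrow> s_sub i (\<phi> i j) w = ev i j * a_sub i (\<phi> i j) w"
    and ev_pos: "\<And>i j. \<lbrakk>i \<in> {1..N}; j \<in> {1..n_sub i}\<rbrakk> \<Longrightarrow> 0 < ev i j"
    and ev_decreasing: "\<And>i j j'. \<lbrakk>i \<in> {1..N}; j \<in> {1..n_sub i}; j' \<in> {1..n_sub i}; j \<le> j'\<rbrakk>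
                          \<Longrightarrow> ev i j' \<le> ev i j"
    and l_le: "\<And>i. i \<in> {1..N} \<Longrightarrow> l i \<le> n_sub i"
    and ev_large: "\<And>i j. \<lbrakk>i \<in> {1..N}; j \<in> {1..l i}\<rbrakk> \<Longrightarrow> \<Lambda> \<le> ev i j"
    and ev_small: "\<And>i j. \<lbrakk>i \<in> {1..N}; j \<in> {l i<..n_sub i}\<rbrakk> \<Longrightarrow> ev i j < \<Lambda>"
    and orthogonal: "\<And>i j j'. \<lbrakk>i \<in> {1..N}; j \<in> {1..n_sub i}; j' \<in> {1..n_sub i}; j \<noteq> j'\<rbrakk>
                       \<Longrightarrow> s_sub i (\<phi> i j) (\<phi> i j') = 0 \<and> a_sub i (\<phi> i j) (\<phi> i j') = 0"
    and normalized: "\<And>i j. \<lbrakk>i \<in> {1..N}; j \<in> {1..n_sub i}\<rbrakk> \<Longrightarrow> s_sub i (\<phi> i j) (\<phi> i j) = 1"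
begin

definition Vaux :: "nat \<Rightarrow> ('a \<Rightarrow> real) set" where
  "Vaux i = fun_space.span (\<phi> i ` {1..l i})"

definition Vtilde :: "('a \<Rightarrow> real) set" where
  "Vtilde = {v \<in> Vh. \<forall>i\<in>{1..N}. \<forall>w\<in>Vaux i. s_sub i v w = 0}"

definition Vcoarse :: "('a \<Rightarrow> real) set" where
  "Vcoarse = {u \<in> Vh. \<forall>v\<in>Vtilde. a u v = 0}"

definition Ah :: "('a \<Rightarrow> real) \<Rightarrow> 'a \<Rightarrow> real" where
  "Ah = form_operator ip Vh a"

definition Aloc :: "nat \<Rightarrow> ('a \<Rightarrow> real) \<Rightarrow> 'a \<Rightarrow> real" where
  "Aloc j = form_operator ip (Vloc j) (form_on (Oext j))"

definition Acoarse :: "('a \<Rightarrow> real) \<Rightarrow> 'a \<Rightarrow> real" where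
  "Acoarse = form_operator ip Vcoarse a"

definition B_inv :: "('a \<Rightarrow> real) \<Rightarrow> 'a \<Rightarrow> real" where
  "B_inv u = (\<Sum>j=1..N. subspace_correction ip (Vloc j) (Aloc j) u)
               + subspace_correction ip Vcoarse Acoarse u"

definition cond_preconditioned :: ereal where
  "cond_preconditioned = cond_number Vh (B_inv \<circ> Ah)"

end

end

(*
  The spectral bounds are read off eigenvectors. For the upper bound, at most M of the extended
  subdomains contain a given element, so the energy of the sum of the local projections is at most
  M times the sum of their energies. For the lower bound, v is split as v0 + w with w the energy
  projection onto Vtilde (hence v0 in the coarse space), and w is split into the nodal interpolants
  of theta_j w. On an element T with inradius at least sigma H, H the mesh size, the gradient of
  such an interpolant is controlled by the differences of its vertex values, which gives

    |grad I(theta w)| <= (2 |grad w| + |w(x)| |grad theta|) / sigma     for every x in T.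

  Being pointwise in x, this can be integrated against any positive weight rho: no regularity of
  rho enters, and summing over j produces M a_i(w,w) and s_i(w,w). On Vtilde the latter is at most
  Lambda a_i(w,w), by expansion in the eigenfunctions.
*)

theory Submission
  imports Defs
begin

text \<open>The coefficient may jump between elements and vary arbitrarily inside one, so a weighted
  inverse or Poincare inequality could bring the contrast into the constant. Everything is therefore
  done element by element: gradients are constant there, and the energy sees rho only through its
  integral over the element. The values of w that remain in the pointwise bound are those that
  \<open>s_sub\<close> measures, with |grad theta|^2 as weight. The resulting constant is (M + 1)
  times 1 + (8 M + 2 \<Lambda>) / \<sigma>^2. In M + 1, M stems from the overlapping local
  projections and 1 from the coarse one. The 8 and 2 come from squaring 2 |grad w| + |w| |grad
  theta|. The number \<sigma> belongs to the family of meshes and is fixed before any coefficient or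
  decomposition. A formal obstacle is that the eigenfunctions live in spaces of functions cut off to
  a subdomain, which jump across faces. The local forms are therefore studied on all functions that
  are affine in the interior of each element; this contains the cut-off functions as well as the
  finite element space.\<close>

section \<open>Symmetric forms on finite-dimensional function spaces\<close>

text \<open>The carrier is explicit because the forms are defined for arbitrary real functions,
  through gradients and integrals that need not exist; they behave bilinearly only on suitable
  subspaces. Positivity is kept apart, since \<open>s_sub\<close> and \<open>a_sub\<close> are used
  as symmetric forms on large spaces with nontrivial null functions.\<close>

locale sym_form =
  fixes V :: "('a \<Rightarrow> real) set" and b :: "('a \<Rightarrow> real) \<Rightarrow> ('a \<Rightarrow> real) \<Rightarrow> real"
  assumes subspace: "fun_space.subspace V"
    and sym: "\<And>u v. \<lbrakk>u \<in> V; v \<in> V\<rbrakk> \<Longrightarrow> b u v = b v u"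
    and add_left: "\<And>u v w. \<lbrakk>u \<in> V; v \<in> V; w \<in> V\<rbrakk> \<Longrightarrow> b (u + v) w = b u w + b v w"
    and scale_left: "\<And>c u v. \<lbrakk>u \<in> V; v \<in> V\<rbrakk> \<Longrightarrow> b (\<lambda>x. c * u x) v = c * b u v"
begin

lemma zero_in: "0 \<in> V"
  using fun_space.subspace_0[OF subspace] .

lemma add_in: "\<lbrakk>u \<in> V; v \<in> V\<rbrakk> \<Longrightarrow> u + v \<in> V"
  using fun_space.subspace_add[OF subspace] .

lemma diff_in: "\<lbrakk>u \<in> V; v \<in> V\<rbrakk> \<Longrightarrow> u - v \<in> V"
  using fun_space.subspace_diff[OF subspace] .

lemma scale_in: "u \<in> V \<Longrightarrow> (\<lambda>x. c * u x) \<in> V"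
  using fun_space.subspace_scale[OF subspace] .

lemma sum_in: "(\<And>i. i \<in> I \<Longrightarrow> f i \<in> V) \<Longrightarrow> sum f I \<in> V"
  using fun_space.subspace_sum[OF subspace] .

lemma add_right: "\<lbrakk>u \<in> V; v \<in> V; w \<in> V\<rbrakk> \<Longrightarrow> b w (u + v) = b w u + b w v"
  by (simp only: sym[of w] add_in add_left)

lemma scale_right: "\<lbrakk>u \<in> V; v \<in> V\<rbrakk> \<Longrightarrow> b v (\<lambda>x. c * u x) = c * b v u"
  by (simp only: sym[of v] scale_in scale_left)

lemma zero_left: "v \<in> V \<Longrightarrow> b 0 v = 0"
  using add_left[of 0 0 v] zero_in by simp

lemma zero_right: "v \<in> V \<Longrightarrow> b v 0 = 0"
  by (simp only: sym[of v] zero_in zero_left)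

lemma diff_left: "\<lbrakk>u \<in> V; v \<in> V; w \<in> V\<rbrakk> \<Longrightarrow> b (u - v) w = b u w - b v w"
  using add_left[of "u - v" v w] diff_in by simp

lemma diff_right: "\<lbrakk>u \<in> V; v \<in> V; w \<in> V\<rbrakk> \<Longrightarrow> b w (u - v) = b w u - b w v"
  by (simp only: sym[of w] diff_in diff_left)

lemma sum_left:
  assumes "\<And>i. i \<in> I \<Longrightarrow> f i \<in> V" "w \<in> V"
  shows "b (sum f I) w = (\<Sum>i\<in>I. b (f i) w)"
  using assms
proof (induction I rule: infinite_finite_induct)
  case (insert i I)
  then have "b (f i + sum f I) w = b (f i) w + (\<Sum>i\<in>I. b (f i) w)"
    using add_left[of "f i" "sum f I" w] sum_in[of I f] by simp
  then show ?case
    unfolding sum.insert[OF insert.hyps] .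
qed (auto simp: zero_left)

lemma sum_right:
  assumes "\<And>i. i \<in> I \<Longrightarrow> f i \<in> V" "w \<in> V"
  shows "b w (sum f I) = (\<Sum>i\<in>I. b w (f i))"
proof -
  have "b w (sum f I) = b (sum f I) w"
    using assms by (intro sym sum_in)
  also have "\<dots> = (\<Sum>i\<in>I. b (f i) w)"
    by (rule sum_left[OF assms])
  also have "\<dots> = (\<Sum>i\<in>I. b w (f i))"
    using assms by (intro sum.cong refl sym)
  finally show ?thesis .
qed

lemma mono_space:
  assumes "fun_space.subspace W" "W \<subseteq> V"
  shows "sym_form W b"
  using assms by unfold_locales (auto intro: sym add_left scale_left)

end

section \<open>Linear functionals and their representers\<close>

definition linear_functional_on :: "('a \<Rightarrow> real) set \<Rightarrow> (('a \<Rightarrow> real) \<Rightarrow> real) \<Rightarrow> bool" where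
  "linear_functional_on V F \<longleftrightarrow> (\<forall>u\<in>V. \<forall>v\<in>V. F (u + v) = F u + F v) \<and>
     (\<forall>c. \<forall>u\<in>V. F (\<lambda>x. c * u x) = c * F u)"

lemma (in sym_form) linear_functional_on_form:
  "u \<in> V \<Longrightarrow> linear_functional_on V (b u)"
  by (simp add: linear_functional_on_def add_right scale_right)

lemma linear_functional_on_subset:
  "linear_functional_on V F \<Longrightarrow> W \<subseteq> V \<Longrightarrow> linear_functional_on W F"
  unfolding linear_functional_on_def by blast

text \<open>Finite dimension is phrased as containment in the span of a finite set that may lie
  outside V; in this form it passes to subspaces unchanged.\<close>

locale inner_form = sym_form +
  assumes pos: "\<And>u. \<lbrakk>u \<in> V; u \<noteq> 0\<rbrakk> \<Longrightarrow> 0 < b u u"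
    and finite_dim: "\<exists>B. finite B \<and> V \<subseteq> fun_space.span B"
begin

lemma nonneg: "u \<in> V \<Longrightarrow> 0 \<le> b u u"
  using pos[of u] zero_left[of 0] zero_in by (cases "u = 0") auto

lemma mono_inner:
  assumes "fun_space.subspace W" "W \<subseteq> V"
  shows "inner_form W b"
proof -
  interpret W: sym_form W b by (rule mono_space[OF assms])
  show ?thesis
    using assms pos finite_dim by unfold_locales blast+
qed

lemma finite_basis:
  obtains B where "finite B" "B \<subseteq> V" "fun_space.span B = V"
proof -
  obtain C where C: "finite C" "V \<subseteq> fun_space.span C"
    using finite_dim by blast
  obtain B where B: "B \<subseteq> V" "fun_space.independent B" "V \<subseteq> fun_space.span B"
    by (rule fun_space.basis_exists[of V])
  then have "finite B"
    using fun_space.independent_span_bound[of C B] C by blast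
  moreover have "fun_space.span B = V"
    using B subspace fun_space.span_minimal[of B V] by blast
  ultimately show ?thesis
    using that B by blast
qed

text \<open>A Gram-Schmidt step drives the induction. Applied to the functional \<open>b e\<close>,
  the induction hypothesis yields the projection p of e onto the span of B, which is why F is
  arbitrary. The remainder c = e - p is orthogonal to that span, so adding a multiple of c to the
  representer w of F on it does no damage there.\<close>

lemma representation_exists_span:
  assumes "finite B" "B \<subseteq> V" "linear_functional_on V F"
  shows "\<exists>w\<in>fun_space.span B. \<forall>v\<in>fun_space.span B. b w v = F v"
  using assms
proof (induction B arbitrary: F rule: finite_induct)
  case empty
  have "F 0 = 0"
    using empty zero_in unfolding linear_functional_on_def
    by (metis add_cancel_right_right)
  then show ?case
    unfolding fun_space.span_empty using zero_left[OF zero_in] by (metis singletonD singletonI)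
next
  case (insert e B)
  have inV: "v \<in> V" if "v \<in> fun_space.span (insert e B)" for v
    using fun_space.span_minimal[OF insert.prems(1) subspace] that by blast
  have eV: "e \<in> V"
    using insert.prems by blast
  have sub: "fun_space.span B \<subseteq> fun_space.span (insert e B)"
    by (rule fun_space.span_mono) blast
  obtain p where p: "p \<in> fun_space.span B" "\<And>v. v \<in> fun_space.span B \<Longrightarrow> b p v = b e v"
    using insert.IH[of "b e"] insert.prems linear_functional_on_form[OF eV] by blast
  obtain w where w: "w \<in> fun_space.span B" "\<And>v. v \<in> fun_space.span B \<Longrightarrow> b w v = F v"
    using insert.IH[of F] insert.prems by blast
  define c where "c = e - p"
  have pV: "p \<in> V" and wV: "w \<in> V"
    using p w inV sub by blast+
  then have cV: "c \<in> V"
    by (simp add: c_def diff_in eV)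
  have c_orth: "b c v = 0" if "v \<in> fun_space.span B" for v
    using that p(2)[of v] inV[of v] sub by (auto simp: c_def diff_left eV pV)
  \<comment> \<open>This t solves \<open>b w c + t * b c c = F c\<close>. If e already lies in the
    span of B, then c = 0 and the equation holds for every t.\<close>
  define t where "t = (F c - b w c) / b c c"
  define z where "z = w + (\<lambda>x. t * c x)"
  have c_span: "c \<in> fun_space.span (insert e B)"
    unfolding c_def using p(1) sub fun_space.span_base[of e "insert e B"]
      fun_space.span_diff[of e "insert e B" p]
    by blast
  have z_span: "z \<in> fun_space.span (insert e B)"
    unfolding z_def using fun_space.span_add[OF _ fun_space.span_scale[OF c_span]] w(1) sub
    by blast
  have tcV: "(\<lambda>x. t * c x) \<in> V" and zV: "z \<in> V"
    using scale_in[OF cV] add_in[OF wV] unfolding z_def by blast+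
  have F0: "F 0 = 0"
    using insert.prems zero_in unfolding linear_functional_on_def
    by (metis add_cancel_right_right)
  have zc: "b z c = F c"
  proof (cases "c = 0")
    case True
    then show ?thesis using zV F0 by (simp add: zero_right)
  next
    case False
    then have "b c c \<noteq> 0" using pos cV by force
    then show ?thesis
      unfolding z_def add_left[OF wV tcV cV] scale_left[OF cV cV] by (simp add: t_def)
  qed
  have "b z v = F v" if v: "v \<in> fun_space.span (insert e B)" for v
  proof -
    obtain s where s: "v - (\<lambda>x. s * e x) \<in> fun_space.span B"
      using v unfolding fun_space.span_breakdown_eq by (elim exE)
    define r where "r = (v - (\<lambda>x. s * e x)) + (\<lambda>x. s * p x)"
    have r: "r \<in> fun_space.span B"
      unfolding r_def by (rule fun_space.span_add[OF s fun_space.span_scale[OF p(1)]])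
    have rV: "r \<in> V" using r sub inV by blast
    have v_eq: "v = r + (\<lambda>x. s * c x)"
      unfolding r_def c_def by (rule ext) (simp add: right_diff_distrib)
    have scV: "(\<lambda>x. s * c x) \<in> V" using cV by (rule scale_in)
    have "b z r = b w r + t * b c r"
      unfolding z_def add_left[OF wV tcV rV] scale_left[OF cV rV] ..
    then have "b z r = F r"
      using w(2)[OF r] c_orth[OF r] by simp
    moreover have "F v = F r + s * F c"
      using insert.prems(2) rV scV cV unfolding v_eq linear_functional_on_def by metis
    moreover have "b z v = b z r + s * b z c"
      unfolding v_eq add_right[OF rV scV zV] scale_right[OF cV zV] ..
    ultimately show ?thesis
      using zc by simp
  qed
  then show ?case using z_span by blast
qed

lemma representation_exists:
  assumes "linear_functional_on V F"
  shows "\<exists>w\<in>V. \<forall>v\<in>V. b w v = F v"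
proof -
  obtain B where B: "finite B" "B \<subseteq> V" "fun_space.span B = V"
    by (rule finite_basis)
  then show ?thesis
    using representation_exists_span[OF B(1,2) assms] by simp
qed

lemma representation_unique:
  assumes "w \<in> V" "w' \<in> V" "\<And>v. v \<in> V \<Longrightarrow> b w v = b w' v"
  shows "w = w'"
proof (rule ccontr)
  assume "w \<noteq> w'"
  then have "0 < b (w - w') (w - w')"
    by (intro pos diff_in assms(1,2)) simp
  moreover have "b (w - w') (w - w') = 0"
    using assms by (simp add: diff_left diff_in)
  ultimately show False by simp
qed

lemma riesz_rep_props:
  assumes "linear_functional_on V F"
  shows "riesz_rep b V F \<in> V" "\<And>v. v \<in> V \<Longrightarrow> b (riesz_rep b V F) v = F v"
proof -
  have "\<exists>!w. w \<in> V \<and> (\<forall>v\<in>V. b w v = F v)"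
    using representation_exists[OF assms] representation_unique by metis
  then have "riesz_rep b V F \<in> V \<and> (\<forall>v\<in>V. b (riesz_rep b V F) v = F v)"
    unfolding riesz_rep_def by (rule theI')
  then show "riesz_rep b V F \<in> V" "\<And>v. v \<in> V \<Longrightarrow> b (riesz_rep b V F) v = F v"
    by blast+
qed

end

text \<open>The pairing \<open>ip\<close> is used once in the adjoint and once in the operator, and
  cancels: the correction represents \<open>ip u\<close> with respect to b. \<open>inv_into\<close>
  merely picks a preimage of q; the b-representer p shows that there is one.\<close>

lemma subspace_correction_props:
  assumes "inner_form W ip" "inner_form W b" "linear_functional_on W (ip u)"
  shows "subspace_correction ip W (form_operator ip W b) u \<in> W"
    and "\<And>v. v \<in> W \<Longrightarrow> b (subspace_correction ip W (form_operator ip W b) u) v = ip u v"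
proof -
  interpret I: inner_form W ip by fact
  interpret B: inner_form W b by fact
  let ?A = "form_operator ip W b"
  define q where "q = adjoint_into ip W id u"
  have q: "q \<in> W" "\<And>v. v \<in> W \<Longrightarrow> ip q v = ip u v"
    using I.riesz_rep_props[OF assms(3)] by (auto simp: q_def adjoint_into_def)
  have A: "?A p \<in> W" "\<And>v. v \<in> W \<Longrightarrow> ip (?A p) v = b p v" if "p \<in> W" for p
    using I.riesz_rep_props[OF B.linear_functional_on_form[OF that]]
    by (auto simp: form_operator_def)
  obtain p where p: "p \<in> W" "\<And>v. v \<in> W \<Longrightarrow> b p v = ip u v"
    using B.representation_exists[OF assms(3)] by blast
  have "?A p = q"
    using A[OF p(1)] p q by (intro I.representation_unique) auto
  then have "q \<in> ?A ` W" using p(1) by blast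
  then have inv: "inv_into W ?A q \<in> W" "?A (inv_into W ?A q) = q"
    by (rule inv_into_into, rule f_inv_into_f)
  then show "subspace_correction ip W ?A u \<in> W"
    by (simp add: subspace_correction_def q_def)
  fix v assume v: "v \<in> W"
  show "b (subspace_correction ip W ?A u) v = ip u v"
    using A(2)[OF inv(1) v] inv(2) q(2)[OF v] by (simp add: subspace_correction_def q_def)
qed

text \<open>
  With \<open>p j\<close> the \<open>b\<close>-projections of \<open>u\<close>, the stable decomposition turns into
  \<open>b u u = \<Sum> b (p j) (w j)\<close>, and Young's inequality with weight \<open>K\<close> absorbs \<open>\<Sum> b (w j) (w j)\<close>.
\<close>
lemma (in inner_form) stable_decomposition_lower_bound:
  assumes u: "u \<in> V" and w: "\<And>j. j \<in> J \<Longrightarrow> w j \<in> V" and p: "\<And>j. j \<in> J \<Longrightarrow> p j \<in> V"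
    and u_eq: "u = sum w J" and "0 < K"
    and stable: "(\<Sum>j\<in>J. b (w j) (w j)) \<le> K * b u u"
    and proj_w: "\<And>j. j \<in> J \<Longrightarrow> b (p j) (w j) = b u (w j)"
    and proj_p: "\<And>j. j \<in> J \<Longrightarrow> b (p j) (p j) = b u (p j)"
  shows "b u u \<le> K * b u (sum p J)"
proof -
  have "2 * b (p j) (w j) \<le> K * b (p j) (p j) + b (w j) (w j) / K" if j: "j \<in> J" for j
  proof -
    \<comment> \<open>Expanding \<open>b ?x ?x \<ge> 0\<close> and dividing by K is the weighted
      Young inequality.\<close>
    let ?x = "(\<lambda>x. K * p j x) - w j"
    have "0 \<le> b ?x ?x"
      by (intro nonneg diff_in scale_in w p j)
    also have "b ?x ?x = K * (K * b (p j) (p j)) - 2 * (K * b (p j) (w j)) + b (w j) (w j)"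
      using w[OF j] p[OF j] sym[of "w j" "p j"]
      by (simp add: diff_left diff_right scale_in diff_in scale_left scale_right algebra_simps)
    finally show ?thesis
      using \<open>0 < K\<close> by (simp add: field_simps power2_eq_square)
  qed
  then have "(\<Sum>j\<in>J. 2 * b (p j) (w j)) \<le> (\<Sum>j\<in>J. K * b (p j) (p j) + b (w j) (w j) / K)"
    by (rule sum_mono)
  moreover have "b u u = (\<Sum>j\<in>J. b (p j) (w j))"
    using sum_right[of J w u] w u proj_w by (simp add: u_eq[symmetric])
  moreover have "b u (sum p J) = (\<Sum>j\<in>J. b (p j) (p j))"
    using sum_right[of J p u] p u proj_p by simp
  moreover have "(\<Sum>j\<in>J. b (w j) (w j)) / K \<le> b u u"
    using stable \<open>0 < K\<close> by (simp add: field_simps)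
  \<comment> \<open>Altogether 2 b(u,u) is at most K b(u, sum p) + b(u,u).\<close>
  ultimately show ?thesis
    by (simp add: sum.distrib sum_distrib_left[symmetric] sum_divide_distrib[symmetric])
qed

section \<open>Piecewise linear functions on a simplicial partition\<close>

lemma sum_apply: "sum f I x = (\<Sum>i\<in>I. f i x)" for f :: "'i \<Rightarrow> 'b \<Rightarrow> real"
proof (induction I rule: infinite_finite_induct)
  case (insert i I)
  then show ?case
    unfolding sum.insert[OF insert.hyps] plus_fun_apply by simp
qed simp_all

text \<open>Relative to one point a the other points are linearly independent, so the prescribed
  increments extend to a linear functional; \<open>adjoint h 1\<close> is the vector representing
  it.\<close>

lemma affine_interpolation_exists:
  fixes C :: "'a::euclidean_space set" and f :: "'a \<Rightarrow> real"
  assumes "\<not> affine_dependent C"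
  shows "\<exists>g c. \<forall>x\<in>C. inner g x + c = f x"
proof (cases "C = {}")
  case False
  then obtain a where a: "a \<in> C" by blast
  have "independent ((\<lambda>x. -a + x) ` (C - {a}))"
    using assms affine_dependent_iff_dependent2[OF a] by blast
  then obtain h where h: "linear h" "\<forall>y\<in>(\<lambda>x. -a + x) ` (C - {a}). h y = f (a + y) - f a"
    using linear_independent_extend[of "(\<lambda>x. -a + x) ` (C - {a})" "\<lambda>y. f (a + y) - f a"] by blast
  define g where "g = adjoint h 1"
  have g: "h y = inner g y" for y
    using adjoint_works[OF h(1), of y 1] by (simp add: g_def inner_commute)
  have "inner g x + (f a - inner g a) = f x" if "x \<in> C" for x
  proof (cases "x = a")
    case False
    then have "h (-a + x) = f x - f a"
      using h(2) that by simp
    then show ?thesis by (simp add: g inner_add_right inner_diff_right)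
  qed simp
  then show ?thesis by blast
qed simp

lemma affine_eq_on_convex_hull:
  fixes g g' :: "'a::real_inner"
  assumes "\<And>x. x \<in> C \<Longrightarrow> inner g x + c = inner g' x + c'" "x \<in> convex hull C"
  shows "inner g x + c = inner g' x + c'"
proof -
  have "C \<subseteq> {x. inner (g - g') x = c' - c}"
    using assms(1) by (force simp: inner_diff_left)
  then have "convex hull C \<subseteq> {x. inner (g - g') x = c' - c}"
    by (rule hull_minimal) (rule convex_hyperplane)
  then have "inner (g - g') x = c' - c" using assms(2) by blast
  then show ?thesis by (simp add: inner_diff_left)
qed

text \<open>Half-spaces are convex, so the bound passes from C to its hull in one variable at a
  time: first y with x a generator, then x.\<close>

lemma oscillation_on_convex_hull:
  fixes g :: "'a::real_inner"
  assumes osc: "\<And>x y. \<lbrakk>x \<in> C; y \<in> C\<rbrakk> \<Longrightarrow> \<bar>inner g x - inner g y\<bar> \<le> K"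
    and xy: "x \<in> convex hull C" "y \<in> convex hull C"
  shows "\<bar>inner g x - inner g y\<bar> \<le> K"
proof -
  have one: "inner g x - inner g y \<le> K" if "x \<in> convex hull C" "y \<in> convex hull C" for x y
  proof -
    have "C \<subseteq> {y. inner g y \<ge> inner g x - K}" if "x \<in> C" for x
      using osc that by force
    then have "convex hull C \<subseteq> {y. inner g y \<ge> inner g x - K}" if "x \<in> C" for x
      using that by (intro hull_minimal convex_halfspace_ge) auto
    then have "inner g y \<ge> inner g x - K" if "x \<in> C" for x
      using that \<open>y \<in> convex hull C\<close> by blast
    then have "C \<subseteq> {x. inner g x \<le> inner g y + K}"
      by force
    then have "convex hull C \<subseteq> {x. inner g x \<le> inner g y + K}"
      by (intro hull_minimal convex_halfspace_le) auto
    then show ?thesis using \<open>x \<in> convex hull C\<close> by auto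
  qed
  show ?thesis using one[OF xy] one[OF xy(2,1)] by linarith
qed

text \<open>Crossing the ball along g changes the function by norm g times the distance, so the
  inradius turns a bound on the oscillation into one on the gradient.\<close>

lemma norm_gradient_le_oscillation:
  fixes g :: "'a::real_inner"
  assumes "ball p r \<subseteq> T" "0 < r"
    and osc: "\<And>x y. \<lbrakk>x \<in> T; y \<in> T\<rbrakk> \<Longrightarrow> \<bar>inner g x - inner g y\<bar> \<le> K"
  shows "norm g * r \<le> K"
proof -
  \<comment> \<open>Half of r on either side of p stays inside the open ball, and for nonzero g the
    distance between the two points is r.\<close>
  define d where "d = (r / 2) *\<^sub>R sgn g"
  have "norm d < r"
    using \<open>0 < r\<close> by (simp add: d_def norm_sgn)
  then have "p + d \<in> T" "p - d \<in> T"
    using assms(1) by (auto simp: subset_iff dist_norm)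
  then have "\<bar>inner g (p + d) - inner g (p - d)\<bar> \<le> K"
    by (rule osc)
  moreover have "inner g (p + d) - inner g (p - d) = r * inner g (sgn g)"
    by (simp add: d_def inner_add_right inner_diff_right)
  moreover have "inner g (sgn g) = norm g"
    by (simp add: sgn_div_norm dot_square_norm power2_eq_square field_simps)
  ultimately show ?thesis by (simp add: mult.commute)
qed

section \<open>Vertices, faces and nodal interpolation on a simplicial mesh\<close>

locale simplicial_mesh =
  fixes \<Omega> :: "'a::euclidean_space set" and \<T> :: "'a set set"
  assumes partition: "simplicial_partition \<Omega> \<T>"
begin

definition vertices :: "'a set \<Rightarrow> 'a set" where
  "vertices T = {x. x extreme_point_of T}"

lemma mesh_nodes_eq: "mesh_nodes \<T> = (\<Union>T\<in>\<T>. vertices T)"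
  by (simp add: mesh_nodes_def vertices_def)

lemma finite_mesh: "finite \<T>"
  and Union_mesh: "\<Union>\<T> = closure \<Omega>"
  and face_Int: "\<lbrakk>T \<in> \<T>; T' \<in> \<T>\<rbrakk> \<Longrightarrow> (T \<inter> T') face_of T"
  and simplex: "T \<in> \<T> \<Longrightarrow> int DIM('a) simplex T"
  using partition unfolding simplicial_partition_def triangulation_def by blast+

lemma vertices_simplex:
  assumes "T \<in> \<T>"
  shows "\<not> affine_dependent (vertices T)" "T = convex hull vertices T" "finite (vertices T)"
proof -
  obtain C where C: "\<not> affine_dependent C" "T = convex hull C"
    using simplex[OF assms] unfolding simplex_def by blast
  then have "vertices T = C"
    using extreme_point_of_convex_hull_affine_independent[OF C(1)] by (auto simp: vertices_def)
  then show "\<not> affine_dependent (vertices T)" "T = convex hull vertices T" "finite (vertices T)"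
    using C aff_independent_finite by auto
qed

lemma vertices_subset: "vertices T \<subseteq> T"
  by (auto simp: vertices_def extreme_point_of_def)

lemma element_props:
  assumes "T \<in> \<T>"
  shows "convex T" "compact T" "closed T" "interior T \<noteq> {}" "T \<noteq> {}" "T \<subseteq> closure \<Omega>"
proof -
  show cT: "convex T" and "compact T" "closed T"
    using simplex[OF assms] convex_simplex compact_simplex closed_simplex by blast+
  have dim: "aff_dim T = int DIM('a)"
    using simplex[OF assms] aff_dim_simplex by blast
  then have "affine hull T = UNIV"
    using aff_dim_eq_full by blast
  then have "interior T = rel_interior T"
    using rel_interior_interior by blast
  moreover show "T \<noteq> {}"
    using dim by auto
  ultimately show "interior T \<noteq> {}"
    using rel_interior_eq_empty[OF cT] by simp
  show "T \<subseteq> closure \<Omega>"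
    using Union_mesh assms by blast
qed

lemma closure_interior_element: "T \<in> \<T> \<Longrightarrow> closure (interior T) = T"
  using element_props convex_closure_interior by (metis closure_closed)

lemma finite_nodes: "finite (mesh_nodes \<T>)"
  using finite_mesh vertices_simplex(3) by (simp add: mesh_nodes_eq)

text \<open>The intersection is a face of both elements, hence the hull of its extreme points, and
  an extreme point of a face is one of the whole simplex. This conformity makes nodal interpolation
  single-valued.\<close>

lemma Int_elements_hull:
  assumes "T \<in> \<T>" "T' \<in> \<T>" "x \<in> T" "x \<in> T'"
  shows "x \<in> convex hull (vertices T \<inter> vertices T')"
proof -
  let ?F = "T \<inter> T'"
  have F: "?F face_of T" "?F face_of T'"
    using face_Int assms(1,2) by (blast, metis Int_commute)
  have "?F = convex hull {v. v extreme_point_of ?F}"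
    using element_props assms(1,2) by (intro Krein_Milman_Minkowski compact_Int convex_Int)
  also have "{v. v extreme_point_of ?F} \<subseteq> vertices T \<inter> vertices T'"
    using F extreme_point_of_face by (auto simp: vertices_def)
  finally show ?thesis
    using assms(3,4) hull_mono by blast
qed

text \<open>The intersection is a face of T. A proper face misses the interior; if it were all of T,
  then T would be a proper face of T' and have smaller dimension, although both are
  full-dimensional.\<close>

lemma disjoint_interior_element:
  assumes "T \<in> \<T>" "T' \<in> \<T>" "T \<noteq> T'"
  shows "T' \<inter> interior T = {}"
proof -
  have "T \<inter> T' \<noteq> T"
  proof
    assume "T \<inter> T' = T"
    then have "T face_of T'"
      using face_Int[of T' T] assms by (metis Int_commute)
    then have "aff_dim T < aff_dim T'"
      using face_of_aff_dim_lt assms element_props by blast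
    then show False
      using aff_dim_simplex simplex assms by (metis less_irrefl)
  qed
  then have "(T \<inter> T') \<inter> interior T = {}"
    using face_Int assms face_of_disjoint_interior by blast
  then show ?thesis using interior_subset by blast
qed

lemma Union_elements_eq:
  assumes "\<D> \<subseteq> \<T>" "T \<in> \<T>" "\<Union>\<D> \<inter> interior T \<noteq> {}"
  shows "T \<in> \<D>"
  using assms disjoint_interior_element by blast

lemma pw_linear_affine:
  assumes "u \<in> pw_linear \<T>" "T \<in> \<T>"
  shows "\<exists>g c. \<forall>x\<in>T. u x = inner g x + c"
  using assms by (auto simp: pw_linear_def)

lemma subspace_pw_linear: "fun_space.subspace (pw_linear \<T>)"
proof (rule fun_space.subspaceI)
  show "0 \<in> pw_linear \<T>"
    by (auto simp: pw_linear_def zero_fun_def intro!: exI[of _ 0])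
next
  fix u v assume u: "u \<in> pw_linear \<T>" and v: "v \<in> pw_linear \<T>"
  have "\<exists>g c. \<forall>x\<in>T. u x + v x = inner g x + c" if "T \<in> \<T>" for T
  proof -
    obtain g c where "\<And>x. x \<in> T \<Longrightarrow> u x = inner g x + c"
      using pw_linear_affine[OF u \<open>T \<in> \<T>\<close>] by metis
    moreover obtain g' c' where "\<And>x. x \<in> T \<Longrightarrow> v x = inner g' x + c'"
      using pw_linear_affine[OF v \<open>T \<in> \<T>\<close>] by metis
    ultimately have "\<forall>x\<in>T. u x + v x = inner (g + g') x + (c + c')"
      by (simp add: inner_add_left)
    then show ?thesis by blast
  qed
  then show "u + v \<in> pw_linear \<T>"
    using u v continuous_on_add[of "\<Union>\<T>" u v] by (simp add: pw_linear_def plus_fun_def)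
next
  fix s :: real and u assume u: "u \<in> pw_linear \<T>"
  have "\<exists>g c. \<forall>x\<in>T. s * u x = inner g x + c" if "T \<in> \<T>" for T
  proof -
    obtain g c where "\<And>x. x \<in> T \<Longrightarrow> u x = inner g x + c"
      using pw_linear_affine[OF u \<open>T \<in> \<T>\<close>] by metis
    then have "\<forall>x\<in>T. s * u x = inner (s *\<^sub>R g) x + s * c"
      by (simp add: algebra_simps)
    then show ?thesis by blast
  qed
  then show "(\<lambda>x. s * u x) \<in> pw_linear \<T>"
    using u by (auto simp: pw_linear_def intro: continuous_on_mult_left)
qed

lemma pw_linear_eq_on_element:
  assumes "u \<in> pw_linear \<T>" "v \<in> pw_linear \<T>" "T \<in> \<T>"
    and "C \<subseteq> T" "x \<in> convex hull C" "\<And>y. y \<in> C \<Longrightarrow> u y = v y"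
  shows "u x = v x"
proof -
  obtain g c where u: "\<And>x. x \<in> T \<Longrightarrow> u x = inner g x + c"
    using pw_linear_affine[OF assms(1,3)] by metis
  obtain g' c' where v: "\<And>x. x \<in> T \<Longrightarrow> v x = inner g' x + c'"
    using pw_linear_affine[OF assms(2,3)] by metis
  have "convex hull C \<subseteq> T"
    using assms element_props by (simp add: hull_minimal)
  then show ?thesis
    using affine_eq_on_convex_hull[of C g c g' c' x] assms u v by (metis subsetD)
qed

lemma pw_linear_eqI:
  assumes "u \<in> pw_linear \<T>" "v \<in> pw_linear \<T>"
    and "\<And>y. y \<in> mesh_nodes \<T> \<Longrightarrow> u y = v y"
  shows "u = v"
proof
  fix x
  show "u x = v x"
  proof (cases "x \<in> \<Union>\<T>")
    case True
    then obtain T where T: "T \<in> \<T>" "x \<in> T" by blast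
    show ?thesis
      using pw_linear_eq_on_element[OF assms(1,2) T(1) vertices_subset] T
        vertices_simplex(2)[OF T(1)] assms(3) by (auto simp: mesh_nodes_eq)
  next
    case False
    then show ?thesis using assms by (simp add: pw_linear_def)
  qed
qed

text \<open>Affine interpolants on the single elements agree at common vertices, hence on common
  faces, so any choice of an element containing x gives the same value. Continuity follows since the
  elements are finitely many closed sets.\<close>

lemma interpolant_exists: "\<exists>u\<in>pw_linear \<T>. \<forall>x\<in>mesh_nodes \<T>. u x = f x"
proof -
  have "\<exists>g c. \<forall>x\<in>vertices T. inner g x + c = f x" if "T \<in> \<T>" for T
    using affine_interpolation_exists vertices_simplex that by blast
  then obtain g c where gc: "\<And>T x. \<lbrakk>T \<in> \<T>; x \<in> vertices T\<rbrakk> \<Longrightarrow> inner (g T) x + c T = f x"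
    by metis
  define u where
    "u x = (if x \<in> \<Union>\<T> then (let T = SOME T. T \<in> \<T> \<and> x \<in> T in inner (g T) x + c T) else 0)" for x
  have u: "u x = inner (g T) x + c T" if T: "T \<in> \<T>" "x \<in> T" for x T
  proof -
    define S where "S = (SOME T. T \<in> \<T> \<and> x \<in> T)"
    have S: "S \<in> \<T>" "x \<in> S"
      using someI[of "\<lambda>T. T \<in> \<T> \<and> x \<in> T" T] T by (auto simp: S_def)
    have "inner (g S) x + c S = inner (g T) x + c T"
    proof (rule affine_eq_on_convex_hull)
      show "x \<in> convex hull (vertices S \<inter> vertices T)"
        by (rule Int_elements_hull[OF S(1) T(1) S(2) T(2)])
    qed (use gc S(1) T(1) in auto)
    moreover have "u x = inner (g S) x + c S"
      using T by (auto simp: u_def S_def Let_def)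
    ultimately show ?thesis by simp
  qed
  have "continuous_on (\<Union>T\<in>\<T>. T) u"
  proof (rule continuous_on_closed_Union)
    fix T assume T: "T \<in> \<T>"
    have "continuous_on T (\<lambda>x. inner (g T) x + c T)"
      by (intro continuous_intros)
    then show "continuous_on T u"
      using u[OF T] by (simp cong: continuous_on_cong)
  qed (use finite_mesh element_props in auto)
  moreover have "\<exists>g c. \<forall>x\<in>T. u x = inner g x + c" if "T \<in> \<T>" for T
    using u that by blast
  moreover have "u x = 0" if "x \<notin> \<Union>\<T>" for x
    using that by (simp add: u_def)
  ultimately have "u \<in> pw_linear \<T>"
    by (simp add: pw_linear_def)
  moreover have "u x = f x" if "x \<in> mesh_nodes \<T>" for x
    using that u gc vertices_subset by (fastforce simp: mesh_nodes_eq)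
  ultimately show ?thesis by blast
qed

text \<open>The description has the same shape as the one defining \<open>theta\<close>, which makes
  \<open>theta i\<close> an interpolant by mere unfolding.\<close>

definition interpolant :: "('a \<Rightarrow> real) \<Rightarrow> 'a \<Rightarrow> real" where
  "interpolant f = (THE u. u \<in> pw_linear \<T> \<and> (\<forall>x\<in>mesh_nodes \<T>. u x = f x))"

lemma interpolant_props:
  "interpolant f \<in> pw_linear \<T>" "x \<in> mesh_nodes \<T> \<Longrightarrow> interpolant f x = f x"
proof -
  have "\<exists>!u. u \<in> pw_linear \<T> \<and> (\<forall>x\<in>mesh_nodes \<T>. u x = f x)"
    using interpolant_exists[of f] pw_linear_eqI by metis
  then have "interpolant f \<in> pw_linear \<T> \<and> (\<forall>x\<in>mesh_nodes \<T>. interpolant f x = f x)"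
    unfolding interpolant_def by (rule theI')
  then show "interpolant f \<in> pw_linear \<T>" "x \<in> mesh_nodes \<T> \<Longrightarrow> interpolant f x = f x"
    by blast+
qed

text \<open>The nodal hat functions \<psi> span, with the values at the nodes as
  coefficients.\<close>

lemma pw_linear_finite_dim: "\<exists>B. finite B \<and> pw_linear \<T> \<subseteq> fun_space.span B"
proof -
  define \<psi> where "\<psi> y = interpolant (\<lambda>x. if x = y then 1 else 0)" for y
  have "u \<in> fun_space.span (\<psi> ` mesh_nodes \<T>)" if u: "u \<in> pw_linear \<T>" for u
  proof -
    let ?v = "\<Sum>y\<in>mesh_nodes \<T>. (\<lambda>x. u y * \<psi> y x)"
    have "?v \<in> pw_linear \<T>"
      by (intro fun_space.subspace_sum[OF subspace_pw_linear]
          fun_space.subspace_scale[OF subspace_pw_linear]) (simp add: \<psi>_def interpolant_props)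
    moreover have "u x = ?v x" if x: "x \<in> mesh_nodes \<T>" for x
    proof -
      have "?v x = (\<Sum>y\<in>mesh_nodes \<T>. if x = y then u y else 0)"
        unfolding sum_apply \<psi>_def using x by (intro sum.cong) (auto simp: interpolant_props)
      then show ?thesis using x finite_nodes by simp
    qed
    ultimately have "u = ?v"
      by (rule pw_linear_eqI[OF u])
    moreover have "?v \<in> fun_space.span (\<psi> ` mesh_nodes \<T>)"
      by (intro fun_space.span_sum fun_space.span_scale fun_space.span_base) blast
    ultimately show ?thesis by simp
  qed
  then show ?thesis
    using finite_nodes by blast
qed

end

section \<open>Element gradients and element integrals\<close>

lemma grad_affine:
  assumes "open S" "x \<in> S" "\<And>y. y \<in> S \<Longrightarrow> u y = inner g y + c"
  shows "grad u x = g"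
proof -
  have "((\<lambda>y. inner g y + c) has_derivative (\<lambda>h. inner h g)) (at x)"
    by (auto intro!: derivative_eq_intros simp: inner_commute)
  then have "GDERIV u x :> g"
    unfolding gderiv_def
    by (rule has_derivative_transform_within_open[OF _ assms(1,2)]) (simp add: assms(3))
  moreover have "D = g" if "GDERIV u x :> D" for D
  proof -
    have "(\<lambda>h. inner h D) = (\<lambda>h. inner h g)"
      using that calculation has_derivative_unique unfolding gderiv_def by blast
    then show ?thesis
      by (metis vector_eq_rdot inner_commute)
  qed
  ultimately show ?thesis
    unfolding grad_def by (rule the_equality)
qed

context simplicial_mesh
begin

text \<open>Only the interior is constrained, so that a function set to zero outside a subdomain,
  which jumps on faces, still qualifies on the elements of the subdomain.\<close>

definition affine_on :: "'a set \<Rightarrow> ('a \<Rightarrow> real) \<Rightarrow> bool" where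
  "affine_on T u \<longleftrightarrow> (\<exists>g c. \<forall>x\<in>interior T. u x = inner g x + c)"

text \<open>For a function affine on the interior the sample point does not matter; it makes the
  element gradient a total function of u.\<close>

definition elem_grad :: "'a set \<Rightarrow> ('a \<Rightarrow> real) \<Rightarrow> 'a" where
  "elem_grad T u = grad u (SOME x. x \<in> interior T)"

lemma elem_grad_eqI:
  assumes "T \<in> \<T>" "\<And>x. x \<in> interior T \<Longrightarrow> u x = inner g x + c"
  shows "elem_grad T u = g"
  unfolding elem_grad_def
proof (rule grad_affine[OF open_interior])
  show "(SOME x. x \<in> interior T) \<in> interior T"
    using element_props(4)[OF assms(1)] by (simp add: some_in_eq)
qed (rule assms(2))

lemma affine_on_obtain:
  assumes "T \<in> \<T>" "affine_on T u"
  shows "\<exists>c. \<forall>x\<in>interior T. u x = inner (elem_grad T u) x + c"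
proof -
  obtain g c where gc: "\<forall>x\<in>interior T. u x = inner g x + c"
    using assms(2) by (auto simp: affine_on_def)
  then have "elem_grad T u = g"
    by (intro elem_grad_eqI[OF assms(1)]) blast
  with gc show ?thesis by blast
qed

lemma grad_eq_elem_grad:
  assumes "T \<in> \<T>" "affine_on T u" "x \<in> interior T"
  shows "grad u x = elem_grad T u"
proof -
  obtain c where "\<forall>x\<in>interior T. u x = inner (elem_grad T u) x + c"
    using affine_on_obtain[OF assms(1,2)] by blast
  then show ?thesis
    using assms(3) by (intro grad_affine[of "interior T"]) auto
qed

lemma elem_grad_cong:
  assumes "T \<in> \<T>" "affine_on T u" "\<And>x. x \<in> interior T \<Longrightarrow> v x = u x"
  shows "affine_on T v" "elem_grad T v = elem_grad T u"
proof -
  obtain c where c: "\<And>x. x \<in> interior T \<Longrightarrow> u x = inner (elem_grad T u) x + c"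
    using affine_on_obtain[OF assms(1,2)] by blast
  then show "affine_on T v"
    using assms(3) unfolding affine_on_def by metis
  show "elem_grad T v = elem_grad T u"
    using c assms(3) by (intro elem_grad_eqI[OF assms(1)]) simp
qed

lemma affine_on_add:
  assumes "T \<in> \<T>" "affine_on T u" "affine_on T v"
  shows "affine_on T (u + v)" "elem_grad T (u + v) = elem_grad T u + elem_grad T v"
proof -
  obtain c d where "\<And>x. x \<in> interior T \<Longrightarrow> u x = inner (elem_grad T u) x + c"
    "\<And>x. x \<in> interior T \<Longrightarrow> v x = inner (elem_grad T v) x + d"
    using affine_on_obtain assms by metis
  then have uv: "(u + v) x = inner (elem_grad T u + elem_grad T v) x + (c + d)"
    if "x \<in> interior T" for x
    using that by (simp add: inner_add_left)
  then show "affine_on T (u + v)" unfolding affine_on_def by blast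
  show "elem_grad T (u + v) = elem_grad T u + elem_grad T v"
    using uv by (rule elem_grad_eqI[OF assms(1)])
qed

lemma affine_on_scale:
  assumes "T \<in> \<T>" "affine_on T u"
  shows "affine_on T (\<lambda>x. s * u x)" "elem_grad T (\<lambda>x. s * u x) = s *\<^sub>R elem_grad T u"
proof -
  obtain c where "\<And>x. x \<in> interior T \<Longrightarrow> u x = inner (elem_grad T u) x + c"
    using affine_on_obtain assms by metis
  then have su: "s * u x = inner (s *\<^sub>R elem_grad T u) x + s * c" if "x \<in> interior T" for x
    using that by (simp add: algebra_simps)
  then show "affine_on T (\<lambda>x. s * u x)" unfolding affine_on_def by blast
  show "elem_grad T (\<lambda>x. s * u x) = s *\<^sub>R elem_grad T u"
    using su by (rule elem_grad_eqI[OF assms(1)])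
qed

lemma affine_on_zero:
  assumes "T \<in> \<T>" "\<And>x. x \<in> interior T \<Longrightarrow> u x = 0"
  shows "affine_on T u" "elem_grad T u = 0"
proof -
  have z: "u x = inner 0 x + 0" if "x \<in> interior T" for x
    using assms(2)[OF that] by simp
  then show "affine_on T u" unfolding affine_on_def by blast
  show "elem_grad T u = 0"
    using z by (rule elem_grad_eqI[OF assms(1)])
qed

lemma pw_linear_elem_grad:
  assumes "u \<in> pw_linear \<T>" "T \<in> \<T>"
  shows "affine_on T u" "\<exists>c. \<forall>x\<in>T. u x = inner (elem_grad T u) x + c"
proof -
  obtain g c where gc: "\<forall>x\<in>T. u x = inner g x + c"
    using pw_linear_affine[OF assms] by metis
  then have "elem_grad T u = g"
    using interior_subset by (intro elem_grad_eqI[OF assms(2)]) blast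
  with gc show "affine_on T u" "\<exists>c. \<forall>x\<in>T. u x = inner (elem_grad T u) x + c"
    using interior_subset unfolding affine_on_def by blast+
qed

lemma elem_grad_sum:
  assumes "T \<in> \<T>" "\<And>i. i \<in> I \<Longrightarrow> f i \<in> pw_linear \<T>"
  shows "elem_grad T (sum f I) = (\<Sum>i\<in>I. elem_grad T (f i))"
  using assms(2)
proof (induction I rule: infinite_finite_induct)
  case (insert i I)
  have "sum f I \<in> pw_linear \<T>"
    using insert.prems by (intro fun_space.subspace_sum[OF subspace_pw_linear]) blast
  moreover have "f i \<in> pw_linear \<T>"
    using insert.prems by blast
  ultimately have "elem_grad T (f i + sum f I) = elem_grad T (f i) + elem_grad T (sum f I)"
    using assms(1) by (intro affine_on_add(2) pw_linear_elem_grad(1))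
  moreover have "elem_grad T (sum f I) = (\<Sum>i\<in>I. elem_grad T (f i))"
    using insert by blast
  ultimately show ?case
    unfolding sum.insert[OF insert.hyps] by metis
qed (simp_all add: affine_on_zero(2)[OF assms(1)])

section \<open>Regions made of elements, and integrals over them\<close>

definition mesh_region :: "'a set \<Rightarrow> bool" where
  "mesh_region U \<longleftrightarrow> (\<exists>\<D>\<subseteq>\<T>. U = interior (\<Union>\<D>))"

definition elements :: "'a set \<Rightarrow> 'a set set" where
  "elements U = {T \<in> \<T>. interior T \<subseteq> U}"

lemma elements_subset: "elements U \<subseteq> \<T>"
  by (auto simp: elements_def)

text \<open>An element whose interior lies in the union meets that union in its interior, so it is
  one of those united. The open set thus remembers its elements although the inner faces have been
  swallowed.\<close>

lemma elements_interior_Union: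
  assumes "\<D> \<subseteq> \<T>"
  shows "elements (interior (\<Union>\<D>)) = \<D>"
proof (intro equalityI subsetI)
  fix T assume T: "T \<in> elements (interior (\<Union>\<D>))"
  then have "T \<in> \<T>" "interior T \<subseteq> \<Union>\<D>"
    using interior_subset by (auto simp: elements_def)
  then show "T \<in> \<D>"
    using Union_elements_eq[OF assms] element_props(4) by blast
next
  fix T assume "T \<in> \<D>"
  then show "T \<in> elements (interior (\<Union>\<D>))"
    using assms by (auto simp: elements_def intro: interior_mono[THEN subsetD])
qed

lemma mesh_region_eq: "mesh_region U \<Longrightarrow> interior (\<Union>(elements U)) = U"
  using elements_interior_Union unfolding mesh_region_def by metis

lemma mesh_region_open: "mesh_region U \<Longrightarrow> open U"
  unfolding mesh_region_def by auto

text \<open>U is open and T is the closure of its interior, so touching U forces the interior of T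
  to meet U. Contrapositively, an element outside an extended subdomain has no vertex in it.\<close>

lemma mesh_region_elementI:
  assumes U: "mesh_region U" and "T \<in> \<T>" "T \<inter> U \<noteq> {}"
  shows "T \<in> elements U"
proof -
  have "U \<inter> closure (interior T) \<noteq> {}"
    using assms closure_interior_element by (simp add: Int_commute)
  then have "U \<inter> interior T \<noteq> {}"
    using open_Int_closure_eq_empty[OF mesh_region_open[OF U]] by blast
  then have "\<Union>(elements U) \<inter> interior T \<noteq> {}"
    using interior_subset mesh_region_eq[OF U] by blast
  then show ?thesis
    using Union_elements_eq[OF elements_subset] assms(2) by blast
qed

lemma closure_mesh_region:
  assumes "mesh_region U"
  shows "closure U = \<Union>(elements U)"
proof
  have "closed (\<Union>(elements U))"
    using finite_subset[OF elements_subset finite_mesh] element_props(3) elements_subset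
    by (intro closed_Union) blast+
  moreover have "U \<subseteq> \<Union>(elements U)"
    using mesh_region_eq[OF assms] interior_subset by metis
  ultimately show "closure U \<subseteq> \<Union>(elements U)"
    by (simp add: closure_minimal)
  show "\<Union>(elements U) \<subseteq> closure U"
  proof
    fix x assume "x \<in> \<Union>(elements U)"
    then obtain T where T: "T \<in> \<T>" "interior T \<subseteq> U" "x \<in> T"
      by (auto simp: elements_def)
    then show "x \<in> closure U"
      using closure_interior_element[OF T(1)] closure_mono[OF T(2)] by auto
  qed
qed

lemma negligible_frontiers:
  assumes "\<D> \<subseteq> \<T>"
  shows "negligible (interior (\<Union>\<D>) - (\<Union>T\<in>\<D>. interior T))"
proof (rule negligible_subset)
  show "negligible (\<Union>T\<in>\<D>. frontier T)"
    using finite_subset[OF assms finite_mesh] element_props(1) assms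
    by (intro negligible_Union) (auto intro: negligible_convex_frontier)
  show "interior (\<Union>\<D>) - (\<Union>T\<in>\<D>. interior T) \<subseteq> (\<Union>T\<in>\<D>. frontier T)"
  proof
    fix x assume x: "x \<in> interior (\<Union>\<D>) - (\<Union>T\<in>\<D>. interior T)"
    then obtain T where "T \<in> \<D>" "x \<in> T" "x \<notin> interior T"
      using interior_subset by blast
    then show "x \<in> (\<Union>T\<in>\<D>. frontier T)"
      using closure_subset by (auto simp: frontier_def)
  qed
qed

text \<open>Faces are null sets and distinct interiors are disjoint, so almost everywhere on U
  exactly one summand survives. Integrability is demanded on single elements only; measurability on
  U follows from the a.e. equality, since Lebesgue measure is complete.\<close>

lemma integral_mesh_region:
  fixes f :: "'a \<Rightarrow> real"
  assumes U: "mesh_region U"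
    and f: "\<And>T. T \<in> elements U \<Longrightarrow> integrable (lebesgue_on (interior T)) f"
  shows "integral\<^sup>L (lebesgue_on U) f = (\<Sum>T\<in>elements U. integral\<^sup>L (lebesgue_on (interior T)) f)"
proof -
  let ?D = "elements U"
  let ?I = "\<Sum>T\<in>?D. integral\<^sup>L (lebesgue_on (interior T)) f"
  have fin: "finite ?D"
    using finite_subset[OF elements_subset finite_mesh] .
  have hT: "has_bochner_integral lebesgue (\<lambda>x. indicator (interior T) x *\<^sub>R f x)
      (integral\<^sup>L (lebesgue_on (interior T)) f)" if "T \<in> ?D" for T
    using f[OF that]
    by (simp add: has_bochner_integral_iff integrable_restrict_space integral_restrict_space)
  have sum: "has_bochner_integral lebesgue (\<lambda>x. \<Sum>T\<in>?D. indicator (interior T) x *\<^sub>R f x) ?I"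
    using hT by (rule has_bochner_integral_sum)
  have "U - (\<Union>T\<in>?D. interior T) \<in> null_sets lebesgue"
    using negligible_frontiers[OF elements_subset, of U] mesh_region_eq[OF U]
    by (simp add: negligible_iff_null_sets)
  then have "AE x in lebesgue. x \<notin> U - (\<Union>T\<in>?D. interior T)"
    by (rule AE_not_in)
  then have ae: "AE x in lebesgue. (\<Sum>T\<in>?D. indicator (interior T) x *\<^sub>R f x) = indicator U x *\<^sub>R f x"
  proof (rule eventually_mono)
    fix x assume x: "x \<notin> U - (\<Union>T\<in>?D. interior T)"
    show "(\<Sum>T\<in>?D. indicator (interior T) x *\<^sub>R f x) = indicator U x *\<^sub>R f x"
    proof (cases "\<exists>T\<in>?D. x \<in> interior T")
      case True
      then obtain T where T: "T \<in> ?D" "x \<in> interior T" by blast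
      have "indicator (interior S) x *\<^sub>R f x = (if S = T then f x else 0)" if "S \<in> ?D" for S
      proof (cases "S = T")
        case False
        then have "S \<inter> interior T = {}"
          using T(1) that elements_subset by (intro disjoint_interior_element) blast+
        then have "x \<notin> interior S"
          using T(2) interior_subset by blast
        then show ?thesis using False by simp
      qed (use T in simp)
      then have "(\<Sum>S\<in>?D. indicator (interior S) x *\<^sub>R f x) = (\<Sum>S\<in>?D. if S = T then f x else 0)"
        by (intro sum.cong refl)
      also have "\<dots> = f x" using fin T by simp
      finally show ?thesis
        using T by (auto simp: elements_def indicator_def)
    next
      case False
      then show ?thesis using x by (auto simp: indicator_def)
    qed
  qed
  have "(\<lambda>x. \<Sum>T\<in>?D. indicator (interior T) x *\<^sub>R f x) \<in> borel_measurable lebesgue"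
    using borel_measurable_has_bochner_integral[OF sum] .
  then have meas: "(\<lambda>x. indicator U x *\<^sub>R f x) \<in> borel_measurable lebesgue"
    using borel_measurable_AE[OF _ ae] by blast
  have "has_bochner_integral lebesgue (\<lambda>x. indicator U x *\<^sub>R f x) ?I"
    by (rule has_bochner_integralI_AE[OF sum meas ae])
  then have "(LINT x|lebesgue. indicator U x *\<^sub>R f x) = ?I"
    by (rule has_bochner_integral_integral_eq)
  then show ?thesis
    using mesh_region_open[OF U] by (simp add: integral_restrict_space)
qed

end

sublocale overlapping_decomposition \<subseteq> simplicial_mesh \<Omega> \<T>
  by unfold_locales (rule mesh)

context overlapping_decomposition
begin

text \<open>A convex open set is the interior of its closure, so no slit along faces separates
  \<Omega> from the union of the mesh.\<close>

lemma mesh_region_domain: "mesh_region \<Omega>" "elements \<Omega> = \<T>"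
proof -
  have eq: "\<Omega> = interior (\<Union>\<T>)"
    using Union_mesh domain convex_interior_closure[of \<Omega>] by (simp add: interior_open)
  show "mesh_region \<Omega>"
    unfolding mesh_region_def using eq by blast
  show "elements \<Omega> = \<T>"
    using elements_interior_Union[of \<T>] eq by simp
qed

lemma coeff_integrable: "integrable (lebesgue_on \<Omega>) \<rho>"
proof -
  obtain K where K: "AE x in lebesgue_on \<Omega>. \<rho> x \<le> K"
    using coeff_bounded by blast
  interpret finite_measure "lebesgue_on \<Omega>"
    by (rule finite_measure_lebesgue_on[OF lmeasurable_open[OF domain(3,1)]])
  have "AE x in lebesgue_on \<Omega>. norm (\<rho> x) \<le> K"
    using K coeff_pos by eventually_elim simp
  then show ?thesis
    using coeff_measurable by (intro integrable_const_bound)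
qed

lemma interior_element_subset: "T \<in> \<T> \<Longrightarrow> interior T \<subseteq> \<Omega>"
  using mesh_region_domain(2) by (auto simp: elements_def)

lemma coeff_integrable_element:
  assumes "T \<in> \<T>"
  shows "integrable (lebesgue_on (interior T)) \<rho>"
proof -
  have "set_integrable lebesgue \<Omega> \<rho>"
    using coeff_integrable domain(1) by (simp add: integrable_restrict_space set_integrable_def)
  then have "set_integrable lebesgue (interior T) \<rho>"
    by (rule set_integrable_subset) (use interior_element_subset[OF assms] in auto)
  then show ?thesis
    by (simp add: integrable_restrict_space set_integrable_def)
qed

lemma coeff_pos_element:
  assumes "T \<in> \<T>"
  shows "AE x in lebesgue_on (interior T). 0 < \<rho> x"
proof -
  have "AE x in lebesgue. x \<in> \<Omega> \<longrightarrow> 0 < \<rho> x"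
    using coeff_pos domain(1) by (simp add: AE_restrict_space_iff)
  then have "AE x in lebesgue. x \<in> interior T \<longrightarrow> 0 < \<rho> x"
    by eventually_elim (use interior_element_subset[OF assms] in blast)
  then show ?thesis
    by (simp add: AE_restrict_space_iff)
qed

text \<open>Gradients being constant on elements, this number is all that the energy form sees of
  rho. In \<open>moment\<close>, by contrast, the variation of rho inside T does count.\<close>

definition weight :: "'a set \<Rightarrow> real" where
  "weight T = (LINT x|lebesgue_on (interior T). \<rho> x)"

definition moment :: "'a set \<Rightarrow> ('a \<Rightarrow> real) \<Rightarrow> ('a \<Rightarrow> real) \<Rightarrow> real" where
  "moment T u w = (LINT x|lebesgue_on (interior T). \<rho> x * u x * w x)"

text \<open>A zero integral of an a.e. positive function would make the nonempty open interior a
  null set.\<close>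

lemma weight_pos:
  assumes "T \<in> \<T>"
  shows "0 < weight T"
proof -
  let ?M = "lebesgue_on (interior T)"
  have nn: "AE x in ?M. 0 \<le> \<rho> x"
    using coeff_pos_element[OF assms] by eventually_elim simp
  have "weight T \<noteq> 0"
  proof
    assume "weight T = 0"
    then have "AE x in ?M. \<rho> x = 0"
      using integral_nonneg_eq_0_iff_AE[OF coeff_integrable_element[OF assms] nn]
      by (simp add: weight_def)
    then have "AE x in ?M. False"
      using coeff_pos_element[OF assms] by eventually_elim simp
    then have "AE x in lebesgue. x \<notin> interior T"
      by (simp add: AE_restrict_space_iff)
    then have "negligible (interior T)"
      using completion.null_sets_iff_AE[of "interior T"] by (simp add: negligible_iff_null_sets)
    then show False
      using open_not_negligible[of "interior T"] element_props(4)[OF assms] by blast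
  qed
  moreover have "0 \<le> weight T"
    unfolding weight_def by (rule integral_nonneg_AE[OF nn])
  ultimately show ?thesis by simp
qed

text \<open>The product of the two affine factors is bounded on the compact element, so a multiple
  of rho dominates.\<close>

lemma integrable_moment:
  assumes T: "T \<in> \<T>" and u: "affine_on T u" and w: "affine_on T w"
  shows "integrable (lebesgue_on (interior T)) (\<lambda>x. \<rho> x * u x * w x)"
proof -
  obtain g c g' c' where u': "\<And>x. x \<in> interior T \<Longrightarrow> u x = inner g x + c"
    and w': "\<And>x. x \<in> interior T \<Longrightarrow> w x = inner g' x + c'"
    using u w unfolding affine_on_def by metis
  let ?q = "\<lambda>x. (inner g x + c) * (inner g' x + c')"
  have cont: "continuous_on S ?q" for S
    by (intro continuous_intros)
  have "bounded (?q ` T)"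
    using compact_continuous_image[OF cont] element_props(2)[OF T] compact_imp_bounded by blast
  then obtain K where K: "\<And>x. x \<in> T \<Longrightarrow> norm (?q x) \<le> K"
    unfolding bounded_iff by blast
  have meas: "?q \<in> borel_measurable (lebesgue_on (interior T))"
    using cont by (intro continuous_imp_measurable_on_sets_lebesgue) auto
  have "integrable (lebesgue_on (interior T)) (\<lambda>x. \<rho> x * ?q x)"
  proof (rule Bochner_Integration.integrable_bound)
    show "integrable (lebesgue_on (interior T)) (\<lambda>x. K * \<rho> x)"
      using coeff_integrable_element[OF T] by simp
    show "(\<lambda>x. \<rho> x * ?q x) \<in> borel_measurable (lebesgue_on (interior T))"
      using borel_measurable_times[OF borel_measurable_integrable[OF coeff_integrable_element[OF T]] meas] .
    show "AE x in lebesgue_on (interior T). norm (\<rho> x * ?q x) \<le> norm (K * \<rho> x)"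
    proof (rule AE_I2)
      fix x assume "x \<in> space (lebesgue_on (interior T))"
      then have "x \<in> T" using interior_subset by auto
      then have "norm (?q x) \<le> norm K"
        by (intro order_trans[OF K]) simp_all
      then have "norm (\<rho> x) * norm (?q x) \<le> norm (\<rho> x) * norm K"
        by (intro mult_left_mono norm_ge_zero)
      then show "norm (\<rho> x * ?q x) \<le> norm (K * \<rho> x)"
        unfolding norm_mult[of "\<rho> x"] norm_mult[of K] by (simp only: mult.commute[of "norm K"])
    qed
  qed
  moreover have "integrable (lebesgue_on (interior T)) (\<lambda>x. \<rho> x * ?q x)
      \<longleftrightarrow> integrable (lebesgue_on (interior T)) (\<lambda>x. \<rho> x * u x * w x)"
    by (rule Bochner_Integration.integrable_cong) (simp_all add: u' w')
  ultimately show ?thesis by blast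
qed

lemma form_on_eq_sum:
  assumes U: "mesh_region U"
    and "\<And>T. T \<in> elements U \<Longrightarrow> affine_on T u" "\<And>T. T \<in> elements U \<Longrightarrow> affine_on T v"
  shows "form_on U u v = (\<Sum>T\<in>elements U. weight T * inner (elem_grad T u) (elem_grad T v))"
proof -
  have eq: "\<rho> x * inner (grad u x) (grad v x) = \<rho> x * inner (elem_grad T u) (elem_grad T v)"
    if "T \<in> elements U" "x \<in> interior T" for T x
    using that grad_eq_elem_grad assms elements_subset by (metis subsetD)
  have int: "integrable (lebesgue_on (interior T)) (\<lambda>x. \<rho> x * inner (grad u x) (grad v x))
      \<longleftrightarrow> integrable (lebesgue_on (interior T)) (\<lambda>x. \<rho> x * inner (elem_grad T u) (elem_grad T v))"
    and lint: "(LINT x|lebesgue_on (interior T). \<rho> x * inner (grad u x) (grad v x))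
      = (LINT x|lebesgue_on (interior T). \<rho> x * inner (elem_grad T u) (elem_grad T v))"
    if "T \<in> elements U" for T
    by (rule Bochner_Integration.integrable_cong Bochner_Integration.integral_cong;
        simp add: eq[OF that])+
  have "form_on U u v = (\<Sum>T\<in>elements U.
      LINT x|lebesgue_on (interior T). \<rho> x * inner (grad u x) (grad v x))"
    unfolding form_on_def
  proof (rule integral_mesh_region[OF U])
    fix T assume T: "T \<in> elements U"
    show "integrable (lebesgue_on (interior T)) (\<lambda>x. \<rho> x * inner (grad u x) (grad v x))"
      unfolding int[OF T] using coeff_integrable_element T elements_subset by auto
  qed
  also have "\<dots> = (\<Sum>T\<in>elements U. weight T * inner (elem_grad T u) (elem_grad T v))"
    unfolding weight_def by (intro sum.cong refl) (simp add: lint)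
  finally show ?thesis .
qed

end

section \<open>The energy form and the local spaces\<close>

context overlapping_decomposition
begin

text \<open>The carrier admits jumps across faces, so that functions of \<open>Vh\<close> and of
  \<open>Vsub i\<close> can be mixed as arguments.\<close>

lemma form_on_sym_form:
  assumes "mesh_region U"
  shows "sym_form {u. \<forall>T\<in>elements U. affine_on T u} (form_on U)"
proof
  let ?X = "{u. \<forall>T\<in>elements U. affine_on T u}"
  have el: "T \<in> \<T>" if "T \<in> elements U" for T
    using that elements_subset by blast
  show sub: "fun_space.subspace ?X"
    using affine_on_add(1) affine_on_scale(1) affine_on_zero(1) el
    by (intro fun_space.subspaceI) simp_all
  have eq: "form_on U u v = (\<Sum>T\<in>elements U. weight T * inner (elem_grad T u) (elem_grad T v))"
    if "u \<in> ?X" "v \<in> ?X" for u v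
    using form_on_eq_sum[OF assms] that by blast
  fix u v assume u: "u \<in> ?X" and v: "v \<in> ?X"
  show "form_on U u v = form_on U v u"
    using eq u v by (simp add: inner_commute)
  fix w assume w: "w \<in> ?X"
  have "elem_grad T (u + v) = elem_grad T u + elem_grad T v" if "T \<in> elements U" for T
    using affine_on_add(2)[OF el[OF that]] u v that by blast
  then show "form_on U (u + v) w = form_on U u w + form_on U v w"
    using eq[OF fun_space.subspace_add[OF sub u v] w] eq[OF u w] eq[OF v w]
    by (simp add: inner_add_left distrib_left sum.distrib)
next
  let ?X = "{u. \<forall>T\<in>elements U. affine_on T u}"
  fix c u v assume u: "u \<in> ?X" and v: "v \<in> ?X"
  have el: "T \<in> \<T>" if "T \<in> elements U" for T
    using that elements_subset by blast
  have cu: "affine_on T (\<lambda>x. c * u x)" "elem_grad T (\<lambda>x. c * u x) = c *\<^sub>R elem_grad T u"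
    if "T \<in> elements U" for T
    using affine_on_scale[OF el[OF that]] u that by blast+
  then show "form_on U (\<lambda>x. c * u x) v = c * form_on U u v"
    using form_on_eq_sum[OF assms, of "\<lambda>x. c * u x" v] form_on_eq_sum[OF assms, of u v] u v
    by (simp add: sum_distrib_left algebra_simps)
qed

lemma Vh_pw_linear: "u \<in> Vh \<Longrightarrow> u \<in> pw_linear \<T>"
  by (simp add: Vh_def fe_space_def)

lemma Vh_affine_on: "\<lbrakk>u \<in> Vh; T \<in> \<T>\<rbrakk> \<Longrightarrow> affine_on T u"
  using pw_linear_elem_grad(1) Vh_pw_linear by blast

lemma subspace_Vh: "fun_space.subspace Vh"
proof (rule fun_space.subspaceI)
  show "0 \<in> Vh"
    using fun_space.subspace_0[OF subspace_pw_linear] by (simp add: Vh_def fe_space_def)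
next
  fix u v assume "u \<in> Vh" "v \<in> Vh"
  then show "u + v \<in> Vh"
    using fun_space.subspace_add[OF subspace_pw_linear, of u v] by (simp add: Vh_def fe_space_def)
next
  fix c u assume "u \<in> Vh"
  then show "(\<lambda>x. c * u x) \<in> Vh"
    using fun_space.subspace_scale[OF subspace_pw_linear, of u c] by (simp add: Vh_def fe_space_def)
qed

lemma Vh_finite_dim: "\<exists>B. finite B \<and> Vh \<subseteq> fun_space.span B"
proof -
  obtain B where B: "finite B" "pw_linear \<T> \<subseteq> fun_space.span B"
    using pw_linear_finite_dim by (elim exE conjE)
  have "Vh \<subseteq> pw_linear \<T>"
    using Vh_pw_linear by (rule subsetI)
  then have "Vh \<subseteq> fun_space.span B"
    using B(2) by (rule subset_trans)
  with B(1) show ?thesis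
    by (intro exI[of _ B] conjI)
qed

lemma a_eq_sum:
  assumes "u \<in> Vh" "v \<in> Vh"
  shows "a u v = (\<Sum>T\<in>\<T>. weight T * inner (elem_grad T u) (elem_grad T v))"
  using form_on_eq_sum[OF mesh_region_domain(1), of u v] Vh_affine_on assms
  unfolding a_def mesh_region_domain(2) by blast

text \<open>Here convexity of \<Omega> does the work. A supporting hyperplane at x cuts out a face
  of T that lies in the frontier, and x is in the hull of the extreme points of this face, which are
  boundary nodes.\<close>

lemma pw_linear_zero_frontier:
  assumes u: "u \<in> pw_linear \<T>"
    and nodes: "\<And>y. \<lbrakk>y \<in> mesh_nodes \<T>; y \<in> frontier \<Omega>\<rbrakk> \<Longrightarrow> u y = 0"
    and x: "x \<in> frontier \<Omega>"
  shows "u x = 0"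
proof -
  have "x \<in> closure \<Omega>"
    using x by (simp add: frontier_def)
  then obtain T where T: "T \<in> \<T>" "x \<in> T"
    using Union_mesh by blast
  have "x \<notin> \<Omega>"
    using x domain(1) by (simp add: frontier_def interior_open)
  then have "{x} \<inter> \<Omega> = {}" by blast
  then obtain d b where d: "d \<noteq> 0" and db: "inner d x \<le> b" "\<forall>y\<in>\<Omega>. b \<le> inner d y"
    using separating_hyperplane_sets[of "{x}" \<Omega>] domain by auto
  have "closure \<Omega> \<subseteq> {y. inner d y \<ge> b}"
    using db(2) by (intro closure_minimal closed_halfspace_ge) blast
  then have dle: "inner d x \<le> inner d y" if "y \<in> closure \<Omega>" for y
    using db(1) that by force
  let ?F = "T \<inter> {y. inner d y = inner d x}"
  have F: "?F face_of T"
    using dle T element_props[OF T(1)]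
    by (intro face_of_Int_supporting_hyperplane_ge) blast+
  have front: "y \<in> frontier \<Omega>" if "y \<in> ?F" for y
  proof -
    have "y \<notin> interior \<Omega>"
    proof
      assume "y \<in> interior \<Omega>"
      then obtain e where e: "0 < e" "cball y e \<subseteq> \<Omega>"
        using mem_interior_cball by blast
      \<comment> \<open>Moving from y against d stays in \<Omega> but falls strictly below the
        minimum of \<open>inner d\<close>, attained at x.\<close>
      let ?z = "y - (e / norm d) *\<^sub>R d"
      have "?z \<in> cball y e"
        using e d by (simp add: dist_norm)
      then have "inner d x \<le> inner d ?z"
        using e closure_subset by (intro dle) blast
      moreover have "inner d ?z = inner d x - e * norm d"
        using that d by (simp add: inner_diff_right power2_norm_eq_inner[symmetric] power2_eq_square)
      ultimately show False
        using e d by (simp add: mult_le_0_iff)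
    qed
    then show ?thesis
      using that element_props(6)[OF T(1)] by (auto simp: frontier_def)
  qed
  have "convex ?F"
    using element_props(1)[OF T(1)] convex_hyperplane by (rule convex_Int)
  moreover have "compact ?F"
    using element_props(2)[OF T(1)] closed_hyperplane by (rule compact_Int_closed)
  ultimately have "?F = convex hull {y. y extreme_point_of ?F}"
    by (intro Krein_Milman_Minkowski)
  moreover have "x \<in> ?F"
    using T by simp
  ultimately have xF: "x \<in> convex hull {y. y extreme_point_of ?F}"
    by blast
  have ext: "y \<in> vertices T \<and> y \<in> ?F" if "y extreme_point_of ?F" for y
    using that extreme_point_of_face[OF F] by (simp add: vertices_def)
  have "u x = (\<lambda>x. 0) x"
  proof (rule pw_linear_eq_on_element[OF u _ T(1) _ xF])
    show "(\<lambda>x. 0) \<in> pw_linear \<T>"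
      using fun_space.subspace_0[OF subspace_pw_linear] by (simp add: zero_fun_def)
    show "{y. y extreme_point_of ?F} \<subseteq> T"
      using ext by blast
    fix y assume "y \<in> {y. y extreme_point_of ?F}"
    then have y: "y \<in> vertices T" "y \<in> ?F"
      using ext by blast+
    then show "u y = 0"
      using nodes[OF _ front[OF y(2)]] T(1) unfolding mesh_nodes_eq by blast
  qed
  then show ?thesis .
qed

text \<open>Zero energy makes all element gradients vanish, the weights being positive. Then u takes
  finitely many values on a connected set, so it is constant by continuity, without following chains
  of adjacent elements; the boundary condition makes the constant 0.\<close>

lemma a_pos:
  assumes u: "u \<in> Vh" and "u \<noteq> 0"
  shows "0 < a u u"
proof (rule ccontr)
  assume "\<not> 0 < a u u"
  then have "(\<Sum>T\<in>\<T>. weight T * inner (elem_grad T u) (elem_grad T u)) \<le> 0"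
    by (simp add: a_eq_sum[OF u u])
  moreover have nn: "0 \<le> weight T * inner (elem_grad T u) (elem_grad T u)" if "T \<in> \<T>" for T
    using weight_pos[OF that] by simp
  ultimately have "weight T * inner (elem_grad T u) (elem_grad T u) = 0" if "T \<in> \<T>" for T
    using sum_nonneg_eq_0_iff[OF finite_mesh nn] sum_nonneg[of \<T>, OF nn] that by force
  then have g0: "elem_grad T u = 0" if "T \<in> \<T>" for T
    using weight_pos[OF that] that by force
  have "\<exists>c. \<forall>x\<in>T. u x = c" if "T \<in> \<T>" for T
    using pw_linear_elem_grad(2)[OF Vh_pw_linear[OF u] that] g0[OF that] by simp
  then obtain c where c: "\<And>T x. \<lbrakk>T \<in> \<T>; x \<in> T\<rbrakk> \<Longrightarrow> u x = c T"
    by metis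
  have "u ` closure \<Omega> \<subseteq> c ` \<T>"
    using c Union_mesh[symmetric] by auto
  then have "finite (u ` closure \<Omega>)"
    using finite_mesh finite_subset by blast
  moreover have "continuous_on (closure \<Omega>) u"
    using Vh_pw_linear[OF u] Union_mesh by (simp add: pw_linear_def)
  moreover have "connected (closure \<Omega>)"
    using domain by (intro convex_connected convex_closure)
  ultimately have "u constant_on closure \<Omega>"
    using continuous_finite_range_constant by blast
  then obtain k where k: "\<And>x. x \<in> closure \<Omega> \<Longrightarrow> u x = k"
    unfolding constant_on_def by blast
  have "frontier \<Omega> \<noteq> {}"
    using domain frontier_not_empty[of \<Omega>] not_bounded_UNIV by blast
  then obtain z where z: "z \<in> frontier \<Omega>" by blast
  have "u z = 0" "z \<in> closure \<Omega>"
    using z u by (auto simp: Vh_def fe_space_def frontier_def)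
  then have "u x = 0" for x
    using k Vh_pw_linear[OF u] Union_mesh unfolding pw_linear_def by (cases "x \<in> closure \<Omega>") auto
  then show False
    using \<open>u \<noteq> 0\<close> by (auto simp: zero_fun_def)
qed

lemma inner_form_a: "inner_form Vh a"
proof -
  interpret X: sym_form "{u. \<forall>T\<in>elements \<Omega>. affine_on T u}" "form_on \<Omega>"
    by (rule form_on_sym_form[OF mesh_region_domain(1)])
  interpret V: sym_form Vh "form_on \<Omega>"
    by (rule X.mono_space[OF subspace_Vh]) (use Vh_affine_on elements_subset in blast)
  show ?thesis
    unfolding a_def[symmetric] by unfold_locales
      (simp_all add: a_def V.add_left V.scale_left V.sym subspace_Vh a_pos[unfolded a_def] Vh_finite_dim)
qed

sublocale energy: inner_form Vh a
  by (rule inner_form_a)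

section \<open>Subdomains and their extensions\<close>

lemma mesh_region_Osub: "i \<in> {1..N} \<Longrightarrow> mesh_region (Osub i)"
  using subdomain unfolding mesh_region_def by blast

lemma mesh_region_Oext:
  assumes "i \<in> {1..N}"
  shows "mesh_region (Oext i)"
proof -
  \<comment> \<open>With at least one layer, the set under \<open>interior\<close> is literally a
    union of elements.\<close>
  obtain m where "k i = Suc m"
    using layers[OF assms] by (cases "k i") auto
  then have "Oext i = interior (add_layer \<T> ((add_layer \<T> ^^ m) (closure (Osub i))))"
    by (simp add: Oext_def extend_by_layers_def)
  moreover have "\<exists>\<D>\<subseteq>\<T>. add_layer \<T> K = \<Union>\<D>" for K
    by (rule exI[of _ "{T \<in> \<T>. T \<inter> K \<noteq> {}}"]) (simp add: add_layer_def Collect_restrict)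
  ultimately show ?thesis
    unfolding mesh_region_def by metis
qed

lemma add_layers_superset:
  assumes "i \<in> {1..N}"
  shows "closure (Osub i) \<subseteq> (add_layer \<T> ^^ m) (closure (Osub i))"
proof (induction m)
  case (Suc m)
  have "closure (Osub i) \<subseteq> \<Union>\<T>"
    using closure_mesh_region[OF mesh_region_Osub[OF assms]] elements_subset by blast
  then have "closure (Osub i) \<subseteq> add_layer \<T> ((add_layer \<T> ^^ m) (closure (Osub i)))"
    using Suc unfolding add_layer_def[of _ "(add_layer \<T> ^^ m) (closure (Osub i))"] by blast
  then show ?case
    by simp
qed simp

lemma Osub_subset_Oext:
  assumes "i \<in> {1..N}"
  shows "Osub i \<subseteq> Oext i"
  unfolding Oext_def extend_by_layers_def
proof (rule interior_maximal)
  show "Osub i \<subseteq> (add_layer \<T> ^^ k i) (closure (Osub i))"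
    using closure_subset add_layers_superset[OF assms] by (rule order_trans)
qed (rule mesh_region_open[OF mesh_region_Osub[OF assms]])

text \<open>The open subdomains miss the interfaces; only their closures cover. One layer added to a
  closed subdomain containing x brings in all elements around x, hence a neighbourhood of x.\<close>

lemma interior_point_in_Oext:
  assumes "x \<in> \<Omega>"
  shows "\<exists>i\<in>{1..N}. x \<in> Oext i"
proof -
  obtain i where i: "i \<in> {1..N}" "x \<in> closure (Osub i)"
    using assms covering closure_subset[of \<Omega>] by blast
  obtain m where m: "k i = Suc m"
    using layers[OF i(1)] by (cases "k i") auto
  \<comment> \<open>S drops the elements that miss x. They are finitely many closed sets, so S is
    open, and each point of S shares an element with x.\<close>
  define S where "S = \<Omega> - \<Union>{T \<in> \<T>. x \<notin> T}"
  have "closed (\<Union>{T \<in> \<T>. x \<notin> T})"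
    using finite_mesh element_props(3) by (intro closed_Union) auto
  then have "open S"
    unfolding S_def using domain(1) by (rule open_Diff[rotated])
  moreover have "S \<subseteq> (add_layer \<T> ^^ k i) (closure (Osub i))"
  proof
    fix y assume y: "y \<in> S"
    then have "y \<in> \<Union>\<T>"
      using Union_mesh closure_subset[of \<Omega>] unfolding S_def by blast
    then obtain T where "T \<in> \<T>" "y \<in> T"
      by blast
    then have "x \<in> T" using y by (auto simp: S_def)
    moreover have "x \<in> (add_layer \<T> ^^ m) (closure (Osub i))"
      using add_layers_superset[OF i(1)] i(2) by blast
    ultimately have "y \<in> add_layer \<T> ((add_layer \<T> ^^ m) (closure (Osub i)))"
      using \<open>T \<in> \<T>\<close> \<open>y \<in> T\<close>
      unfolding add_layer_def[of _ "(add_layer \<T> ^^ m) (closure (Osub i))"] by blast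
    then show "y \<in> (add_layer \<T> ^^ k i) (closure (Osub i))"
      by (simp add: m)
  qed
  moreover have "x \<in> S"
    using assms by (simp add: S_def)
  ultimately have "x \<in> Oext i"
    unfolding Oext_def extend_by_layers_def by (meson interiorI)
  then show ?thesis using i by blast
qed

lemma elements_Osub_disjoint:
  assumes "i \<in> {1..N}" "j \<in> {1..N}" "i \<noteq> j"
  shows "elements (Osub i) \<inter> elements (Osub j) = {}"
proof (rule ccontr)
  assume "elements (Osub i) \<inter> elements (Osub j) \<noteq> {}"
  then obtain T where "T \<in> \<T>" "interior T \<subseteq> Osub i" "interior T \<subseteq> Osub j"
    by (auto simp: elements_def)
  then show False
    using nonoverlapping[OF assms] element_props(4) by blast
qed

lemma elements_cover: "(\<Union>i\<in>{1..N}. elements (Osub i)) = \<T>"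
proof
  show "\<T> \<subseteq> (\<Union>i\<in>{1..N}. elements (Osub i))"
  proof
    fix T assume T: "T \<in> \<T>"
    let ?D = "\<Union>i\<in>{1..N}. elements (Osub i)"
    have "(\<Union>i\<in>{1..N}. closure (Osub i)) = (\<Union>i\<in>{1..N}. \<Union>(elements (Osub i)))"
      by (intro SUP_cong refl closure_mesh_region mesh_region_Osub)
    then have "closure \<Omega> = \<Union>?D"
      unfolding covering by blast
    then have "interior T \<subseteq> \<Union>?D"
      using element_props(6)[OF T] interior_subset[of T] by blast
    then have "\<Union>?D \<inter> interior T \<noteq> {}"
      using element_props(4)[OF T] by (metis inf.absorb2)
    moreover have "?D \<subseteq> \<T>"
      using elements_subset by (rule UN_least)
    ultimately show "T \<in> ?D"
      by (intro Union_elements_eq[OF _ T])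
  qed
qed (use elements_subset in blast)

lemma sum_elements:
  "(\<Sum>T\<in>\<T>. f T) = (\<Sum>i=1..N. \<Sum>T\<in>elements (Osub i). f T)" for f :: "'a set \<Rightarrow> real"
proof -
  have "(\<Sum>T\<in>(\<Union>i\<in>{1..N}. elements (Osub i)). f T) = (\<Sum>i=1..N. \<Sum>T\<in>elements (Osub i). f T)"
    by (rule sum.UNION_disjoint)
      (use elements_Osub_disjoint finite_subset[OF elements_subset finite_mesh] in blast)+
  then show ?thesis
    unfolding elements_cover .
qed

lemma finite_neighbours: "finite (neighbours i)"
  by (simp add: neighbours_def)

lemma card_neighbours_le: "i \<in> {1..N} \<Longrightarrow> card (neighbours i) \<le> overlap_number"
  unfolding overlap_number_def by (intro Max_ge finite_imageI imageI) simp_all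

section \<open>Local spaces and the overlap bound\<close>

lemma Vloc_subset: "Vloc j \<subseteq> Vh"
  by (auto simp: Vloc_def)

lemma subspace_Vloc: "fun_space.subspace (Vloc j)"
proof (rule fun_space.subspaceI)
  show "0 \<in> Vloc j"
    by (simp add: Vloc_def energy.zero_in)
next
  fix u v assume uv: "u \<in> Vloc j" "v \<in> Vloc j"
  have "closure {x. (u + v) x \<noteq> 0} \<subseteq> closure ({x. u x \<noteq> 0} \<union> {x. v x \<noteq> 0})"
    by (rule closure_mono) auto
  then show "u + v \<in> Vloc j"
    using uv energy.add_in unfolding closure_Un by (auto simp only: Vloc_def)
next
  fix c :: real and u assume u: "u \<in> Vloc j"
  have "closure {x. c * u x \<noteq> 0} \<subseteq> closure {x. u x \<noteq> 0}"
    by (rule closure_mono) auto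
  then show "(\<lambda>x. c * u x) \<in> Vloc j"
    using u energy.scale_in[of u c] by (auto simp: Vloc_def)
qed

text \<open>The closure of \<open>Oext j\<close> is the union of its elements and misses the
  interior of every other one, so the support condition leaves u zero there.\<close>

lemma Vloc_elem_grad_zero:
  assumes "j \<in> {1..N}" "u \<in> Vloc j" "T \<in> \<T>" "T \<notin> elements (Oext j)"
  shows "elem_grad T u = 0"
proof (rule affine_on_zero(2)[OF assms(3)], rule ccontr)
  fix x assume x: "x \<in> interior T" and "u x \<noteq> 0"
  then have "x \<in> closure (Oext j)"
    using assms(2) closure_subset[of "{x. u x \<noteq> 0}"] by (auto simp: Vloc_def)
  then have "\<Union>(elements (Oext j)) \<inter> interior T \<noteq> {}"
    using x closure_mesh_region[OF mesh_region_Oext[OF assms(1)]] by blast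
  then show False
    using Union_elements_eq[OF elements_subset assms(3)] assms(4) by blast
qed

lemma form_on_Oext:
  assumes "j \<in> {1..N}" "u \<in> Vloc j" "v \<in> Vloc j"
  shows "form_on (Oext j) u v = a u v"
proof -
  have uv: "u \<in> Vh" "v \<in> Vh"
    using assms Vloc_subset by blast+
  have "form_on (Oext j) u v
      = (\<Sum>T\<in>elements (Oext j). weight T * inner (elem_grad T u) (elem_grad T v))"
    using uv Vh_affine_on elements_subset by (intro form_on_eq_sum mesh_region_Oext assms(1)) blast+
  also have "\<dots> = (\<Sum>T\<in>\<T>. weight T * inner (elem_grad T u) (elem_grad T v))"
    using Vloc_elem_grad_zero[OF assms(1,2)] finite_mesh elements_subset
    by (intro sum.mono_neutral_left) auto
  finally show ?thesis
    by (simp add: a_eq_sum[OF uv])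
qed

text \<open>Any two extended subdomains that contain a common element are neighbours of each other.\<close>
lemma card_Oext_element_le:
  assumes "T \<in> \<T>"
  shows "card {j \<in> {1..N}. T \<in> elements (Oext j)} \<le> overlap_number"
proof (cases "{j \<in> {1..N}. T \<in> elements (Oext j)} = {}")
  case False
  then obtain i where i: "i \<in> {1..N}" "T \<in> elements (Oext i)" by blast
  have "{j \<in> {1..N}. T \<in> elements (Oext j)} \<subseteq> neighbours i"
    using i(2) element_props(4)[OF assms] by (auto simp: elements_def neighbours_def)
  then show ?thesis
    using card_mono[OF finite_neighbours] card_neighbours_le[OF i(1)] by (meson order_trans)
next
  case True
  then show ?thesis by (simp only: card.empty le0)
qed

text \<open>Cauchy-Schwarz is applied on each element, to the indices active on that element, and
  not globally; this is how N stays out of the bound.\<close>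

lemma energy_sum_Vloc_le:
  assumes p: "\<And>j. j \<in> {1..N} \<Longrightarrow> p j \<in> Vloc j"
  shows "a (sum p {1..N}) (sum p {1..N}) \<le> real overlap_number * (\<Sum>j=1..N. a (p j) (p j))"
proof -
  let ?G = "\<lambda>T j. elem_grad T (p j)"
  have pV: "p j \<in> Vh" if "j \<in> {1..N}" for j
    using p[OF that] Vloc_subset by blast
  have T_bound: "(norm (\<Sum>j=1..N. ?G T j))\<^sup>2 \<le> real overlap_number * (\<Sum>j=1..N. (norm (?G T j))\<^sup>2)"
    if T: "T \<in> \<T>" for T
  proof -
    let ?J = "{j \<in> {1..N}. T \<in> elements (Oext j)}"
    have zero: "?G T j = 0" if "j \<in> {1..N} - ?J" for j
      using that Vloc_elem_grad_zero[OF _ p T] by blast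
    have "(\<Sum>j=1..N. ?G T j) = (\<Sum>j\<in>?J. ?G T j)"
      using zero by (intro sum.mono_neutral_right) auto
    then have "norm (\<Sum>j=1..N. ?G T j) \<le> (\<Sum>j\<in>?J. norm (?G T j))"
      by (metis norm_sum)
    then have "(norm (\<Sum>j=1..N. ?G T j))\<^sup>2 \<le> (\<Sum>j\<in>?J. norm (?G T j))\<^sup>2"
      by (intro power_mono) auto
    also have "\<dots> \<le> (\<Sum>j\<in>?J. (norm (?G T j))\<^sup>2) * card ?J"
      by (rule sum_squared_le_sum_of_squares)
    also have "\<dots> \<le> (\<Sum>j\<in>?J. (norm (?G T j))\<^sup>2) * real overlap_number"
      using card_Oext_element_le[OF T] by (intro mult_left_mono sum_nonneg) auto
    also have "(\<Sum>j\<in>?J. (norm (?G T j))\<^sup>2) = (\<Sum>j=1..N. (norm (?G T j))\<^sup>2)"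
      using zero by (intro sum.mono_neutral_left) auto
    finally show ?thesis by (simp add: mult.commute)
  qed
  have sumV: "sum p {1..N} \<in> Vh"
    using pV by (rule energy.sum_in)
  have "a (sum p {1..N}) (sum p {1..N}) = (\<Sum>T\<in>\<T>. weight T * (norm (\<Sum>j=1..N. ?G T j))\<^sup>2)"
    unfolding a_eq_sum[OF sumV sumV] using elem_grad_sum[of _ "{1..N}" p] pV Vh_pw_linear
    by (intro sum.cong refl) (simp add: power2_norm_eq_inner)
  also have "\<dots> \<le> (\<Sum>T\<in>\<T>. weight T * (real overlap_number * (\<Sum>j=1..N. (norm (?G T j))\<^sup>2)))"
    using T_bound weight_pos by (intro sum_mono mult_left_mono) (auto intro: less_imp_le)
  also have "\<dots> = real overlap_number * (\<Sum>j=1..N. \<Sum>T\<in>\<T>. weight T * (norm (?G T j))\<^sup>2)"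
    by (subst sum.swap) (simp add: sum_distrib_left algebra_simps)
  also have "(\<Sum>j=1..N. \<Sum>T\<in>\<T>. weight T * (norm (?G T j))\<^sup>2) = (\<Sum>j=1..N. a (p j) (p j))"
    using pV by (intro sum.cong refl) (simp add: a_eq_sum power2_norm_eq_inner)
  finally show ?thesis .
qed

end

section \<open>Stable decomposition\<close>

text \<open>
  Only differences of vertex values enter, so the bound holds at every point \<open>x\<close> of the element
  and can be integrated against an arbitrary weight; no inverse inequality is needed.
\<close>
lemma (in simplicial_mesh) interpolated_product_gradient:
  assumes T: "T \<in> \<T>" and ball: "ball p r \<subseteq> T"
    and "0 < \<sigma>" "0 < H" "\<sigma> * H \<le> r" and diam: "diameter T \<le> H"
    and \<theta>: "\<theta> \<in> pw_linear \<T>" and w: "w \<in> pw_linear \<T>" and v: "v \<in> pw_linear \<T>"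
    and \<theta>01: "\<And>y. y \<in> vertices T \<Longrightarrow> 0 \<le> \<theta> y \<and> \<theta> y \<le> 1"
    and prod: "\<And>y. y \<in> vertices T \<Longrightarrow> v y = \<theta> y * w y"
    and x: "x \<in> T"
  shows "norm (elem_grad T v) \<le> (2 * norm (elem_grad T w) + norm (elem_grad T \<theta>) * \<bar>w x\<bar>) / \<sigma>"
proof -
  have lip: "\<bar>u y - u z\<bar> \<le> norm (elem_grad T u) * H"
    if u: "u \<in> pw_linear \<T>" and yz: "y \<in> T" "z \<in> T" for u y z
  proof -
    obtain c where "\<forall>x\<in>T. u x = inner (elem_grad T u) x + c"
      using pw_linear_elem_grad(2)[OF u T] by blast
    then have "u y - u z = inner (elem_grad T u) (y - z)"
      using yz by (simp add: inner_diff_right)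
    also have "\<bar>\<dots>\<bar> \<le> norm (elem_grad T u) * norm (y - z)"
      by (rule Cauchy_Schwarz_ineq2)
    also have "norm (y - z) \<le> H"
      using diameter_bounded_bound[of T y z] compact_imp_bounded[OF element_props(2)[OF T]] yz diam
      by (simp add: dist_norm)
    finally show ?thesis
      by (simp add: mult_left_mono)
  qed
  let ?A = "norm (elem_grad T w)" and ?B = "norm (elem_grad T \<theta>)"
  let ?D = "(2 * ?A + ?B * \<bar>w x\<bar>) * H"
  have osc: "\<bar>v y - v z\<bar> \<le> ?D" if yz: "y \<in> vertices T" "z \<in> vertices T" for y z
  proof -
    have yzT: "y \<in> T" "z \<in> T"
      using yz vertices_subset by blast+
    \<comment> \<open>Discrete product rule: \<theta> at y weighs the difference of w, and w at z
      weighs the difference of \<theta>.\<close>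
    have "v y - v z = \<theta> y * (w y - w z) + w z * (\<theta> y - \<theta> z)"
      using prod yz by (simp add: algebra_simps)
    then have "\<bar>v y - v z\<bar> \<le> \<bar>\<theta> y\<bar> * \<bar>w y - w z\<bar> + \<bar>w z\<bar> * \<bar>\<theta> y - \<theta> z\<bar>"
      by (metis abs_mult abs_triangle_ineq)
    also have "\<bar>\<theta> y\<bar> * \<bar>w y - w z\<bar> \<le> 1 * (?A * H)"
      using \<theta>01[OF yz(1)] lip[OF w yzT] by (intro mult_mono) auto
    \<comment> \<open>Passing from w z to w x frees the choice of x. The price is a second copy of
      \<open>?A * H\<close>, as a difference of values of \<theta> is at most 1.\<close>
    also have "\<bar>w z\<bar> * \<bar>\<theta> y - \<theta> z\<bar> \<le> (\<bar>w x\<bar> + ?A * H) * \<bar>\<theta> y - \<theta> z\<bar>"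
      using lip[OF w yzT(2) x] by (intro mult_right_mono) auto
    also have "\<dots> = \<bar>w x\<bar> * \<bar>\<theta> y - \<theta> z\<bar> + ?A * H * \<bar>\<theta> y - \<theta> z\<bar>"
      by (simp add: distrib_right)
    also have "\<bar>w x\<bar> * \<bar>\<theta> y - \<theta> z\<bar> \<le> \<bar>w x\<bar> * (?B * H)"
      using lip[OF \<theta> yzT] by (intro mult_left_mono) auto
    also have "?A * H * \<bar>\<theta> y - \<theta> z\<bar> \<le> ?A * H * 1"
      using \<theta>01[OF yz(1)] \<theta>01[OF yz(2)] \<open>0 < H\<close> by (intro mult_left_mono) auto
    finally show ?thesis
      by (simp add: algebra_simps)
  qed
  obtain c where c: "\<forall>x\<in>T. v x = inner (elem_grad T v) x + c"
    using pw_linear_elem_grad(2)[OF v T] by blast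
  have "\<bar>inner (elem_grad T v) y - inner (elem_grad T v) z\<bar> \<le> ?D"
    if "y \<in> vertices T" "z \<in> vertices T" for y z
    using osc[OF that] c vertices_subset that by (metis add_diff_cancel_right subsetD)
  then have "\<bar>inner (elem_grad T v) y - inner (elem_grad T v) z\<bar> \<le> ?D"
    if "y \<in> T" "z \<in> T" for y z
    using oscillation_on_convex_hull[of "vertices T"] vertices_simplex(2)[OF T] that by metis
  moreover have "0 < \<sigma> * H"
    using assms(3,4) by simp
  ultimately have "norm (elem_grad T v) * r \<le> ?D"
    using assms(5) by (intro norm_gradient_le_oscillation[OF ball]) auto
  moreover have "norm (elem_grad T v) * (\<sigma> * H) \<le> norm (elem_grad T v) * r"
    using assms(5) by (intro mult_left_mono) auto
  \<comment> \<open>The oscillation is of order H and the inradius at least \<sigma> times H, so the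
    mesh size cancels.\<close>
  ultimately have "(norm (elem_grad T v) * \<sigma>) * H \<le> (2 * ?A + ?B * \<bar>w x\<bar>) * H"
    by (simp add: mult.assoc)
  then have "norm (elem_grad T v) * \<sigma> \<le> 2 * ?A + ?B * \<bar>w x\<bar>"
    using \<open>0 < H\<close> by (simp only: mult_le_cancel_right_pos)
  then show ?thesis
    using \<open>0 < \<sigma>\<close> by (simp add: pos_le_divide_eq)
qed

context overlapping_decomposition
begin

section \<open>Partition of unity and the interpolated pieces\<close>

lemma theta_props:
  "theta i \<in> pw_linear \<T>"
  "y \<in> mesh_nodes \<T> \<Longrightarrow>
     theta i y = (if node_in y i then 1 / real (card {j \<in> {1..N}. node_in y j}) else 0)"
  using interpolant_props[where f = "\<lambda>x. if node_in x i then 1 / real (card {j \<in> {1..N}. node_in x j}) else 0"]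
  unfolding interpolant_def theta_def[symmetric] by blast+

lemma theta_range:
  assumes "y \<in> mesh_nodes \<T>"
  shows "0 \<le> theta i y \<and> theta i y \<le> 1"
proof -
  have "0 \<le> 1 / real n \<and> 1 / real n \<le> 1" for n
    by (cases n) auto
  then show ?thesis
    unfolding theta_props(2)[OF assms] by simp
qed

text \<open>An interior node lies in some extended subdomain, so the cardinality in the denominator
  is not 0. Interior nodes are what the splitting of w calls for, as w vanishes at the
  others.\<close>

lemma sum_theta_interior:
  assumes y: "y \<in> mesh_nodes \<T>" "y \<in> \<Omega>"
  shows "(\<Sum>i=1..N. theta i y) = 1"
proof -
  let ?J = "{j \<in> {1..N}. node_in y j}"
  have cancel: "c * (1 / c) = 1" if "c \<noteq> 0" for c :: real
    using that by simp
  have nonempty: "?J \<noteq> {}"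
    using interior_point_in_Oext[OF y(2)] by (auto simp: node_in_def)
  have "(\<Sum>i=1..N. theta i y) = (\<Sum>i=1..N. if node_in y i then 1 / real (card ?J) else 0)"
    using theta_props(2)[OF y(1)] by (intro sum.cong refl) blast
  also have "\<dots> = (\<Sum>i\<in>?J. 1 / real (card ?J))"
    by (simp add: sum.If_cases Int_def)
  also have "\<dots> = real (card ?J) * (1 / real (card ?J))"
    by (simp only: sum_constant)
  also have "real (card ?J) * (1 / real (card ?J)) = 1"
    using nonempty by (intro cancel) (simp only: of_nat_eq_0_iff card_eq_0_iff, simp)
  finally show ?thesis .
qed

text \<open>The product itself is piecewise quadratic; interpolation brings it back to the finite
  element space.\<close>

definition piece :: "nat \<Rightarrow> ('a \<Rightarrow> real) \<Rightarrow> 'a \<Rightarrow> real" where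
  "piece i w = interpolant (\<lambda>y. theta i y * w y)"

lemma piece_props:
  "piece i w \<in> pw_linear \<T>"
  "y \<in> mesh_nodes \<T> \<Longrightarrow> piece i w y = theta i y * w y"
  using interpolant_props unfolding piece_def by blast+

lemma Vh_frontier: "\<lbrakk>w \<in> Vh; y \<in> frontier \<Omega>\<rbrakk> \<Longrightarrow> w y = 0"
  by (simp add: Vh_def fe_space_def)

lemma node_cases:
  assumes "y \<in> mesh_nodes \<T>"
  obtains "y \<in> \<Omega>" | "y \<in> frontier \<Omega>"
proof -
  have "y \<in> closure \<Omega>"
    using assms vertices_subset element_props(6) unfolding mesh_nodes_eq by blast
  then show ?thesis
    using that domain(1) by (auto simp: frontier_def interior_open)
qed

text \<open>At interior nodes of T the factor \<open>theta i\<close> vanishes. At boundary nodes it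
  may not, but there w does.\<close>

lemma piece_zero_element:
  assumes i: "i \<in> {1..N}" and w: "w \<in> Vh" and T: "T \<in> \<T>" "T \<notin> elements (Oext i)" and x: "x \<in> T"
  shows "piece i w x = 0"
proof -
  have zero: "(\<lambda>x. 0) \<in> pw_linear \<T>"
    using fun_space.subspace_0[OF subspace_pw_linear] by (simp add: zero_fun_def)
  have x': "x \<in> convex hull (vertices T)"
    using x vertices_simplex(2)[OF T(1)] by simp
  have "piece i w x = (\<lambda>x. 0) x"
  proof (rule pw_linear_eq_on_element[OF piece_props(1) zero T(1) vertices_subset x'])
    fix y assume y: "y \<in> vertices T"
    then have node: "y \<in> mesh_nodes \<T>"
      using T(1) by (auto simp: mesh_nodes_eq)
    from node show "piece i w y = 0"
    proof (cases rule: node_cases)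
      case 1
      have "y \<notin> Oext i"
        using mesh_region_elementI[OF mesh_region_Oext[OF i] T(1)] T(2) y vertices_subset by blast
      moreover have "y \<notin> frontier \<Omega>"
        using 1 domain(1) by (simp add: frontier_def interior_open)
      ultimately have "theta i y = 0"
        using theta_props(2)[OF node] by (simp add: node_in_def)
      then show ?thesis
        using piece_props(2)[OF node] by simp
    next
      case 2
      then show ?thesis
        using piece_props(2)[OF node] Vh_frontier[OF w] by simp
    qed
  qed
  then show ?thesis .
qed

lemma piece_in_Vloc:
  assumes i: "i \<in> {1..N}" and w: "w \<in> Vh"
  shows "piece i w \<in> Vloc i"
proof -
  have "piece i w x = 0" if "x \<in> frontier \<Omega>" for x
  proof (rule pw_linear_zero_frontier[OF piece_props(1) _ that])
    fix y assume "y \<in> mesh_nodes \<T>" "y \<in> frontier \<Omega>"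
    then show "piece i w y = 0"
      using piece_props(2) Vh_frontier[OF w] by simp
  qed
  then have "piece i w \<in> Vh"
    by (simp add: Vh_def fe_space_def piece_props(1))
  moreover have "{x. piece i w x \<noteq> 0} \<subseteq> closure (Oext i)"
  proof
    fix x assume "x \<in> {x. piece i w x \<noteq> 0}"
    then have nz: "piece i w x \<noteq> 0" by simp
    then have "x \<in> \<Union>\<T>"
      using piece_props(1)[of i w] unfolding pw_linear_def by blast
    then obtain T where T: "T \<in> \<T>" "x \<in> T" by blast
    then have "T \<in> elements (Oext i)"
      using piece_zero_element[OF i w T(1) _ T(2)] nz by blast
    then show "x \<in> closure (Oext i)"
      using closure_mesh_region[OF mesh_region_Oext[OF i]] T(2) by blast
  qed
  then have "closure {x. piece i w x \<noteq> 0} \<subseteq> closure (Oext i)"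
    by (simp add: closure_minimal)
  ultimately show ?thesis
    by (simp add: Vloc_def)
qed

lemma sum_pieces:
  assumes w: "w \<in> Vh"
  shows "(\<Sum>i=1..N. piece i w) = w"
proof (rule pw_linear_eqI)
  show "(\<Sum>i=1..N. piece i w) \<in> pw_linear \<T>"
    by (rule fun_space.subspace_sum[OF subspace_pw_linear]) (rule piece_props(1))
  show "w \<in> pw_linear \<T>"
    by (rule Vh_pw_linear[OF w])
  fix y assume y: "y \<in> mesh_nodes \<T>"
  have "(\<Sum>i=1..N. piece i w) y = (\<Sum>i=1..N. theta i y) * w y"
    unfolding sum_apply piece_props(2)[OF y] by (rule sum_distrib_right[symmetric])
  also from y have "\<dots> = w y"
  proof (cases rule: node_cases)
    case 1
    then show ?thesis using sum_theta_interior[OF y] by simp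
  next
    case 2
    then show ?thesis using Vh_frontier[OF w] by simp
  qed
  finally show "(\<Sum>i=1..N. piece i w) y = w y" .
qed

section \<open>Energy of the pieces\<close>

definition theta_energy :: "nat \<Rightarrow> 'a set \<Rightarrow> real" where
  "theta_energy i T = (\<Sum>j\<in>neighbours i. (norm (elem_grad T (theta j)))\<^sup>2)"

lemma s_sub_eq_sum:
  assumes i: "i \<in> {1..N}"
    and u: "\<And>T. T \<in> elements (Osub i) \<Longrightarrow> affine_on T u"
    and w: "\<And>T. T \<in> elements (Osub i) \<Longrightarrow> affine_on T w"
  shows "s_sub i u w = (\<Sum>T\<in>elements (Osub i). theta_energy i T * moment T u w)"
proof -
  let ?f = "\<lambda>x. \<rho> x * (\<Sum>j\<in>neighbours i. (norm (grad (theta j) x))\<^sup>2) * u x * w x"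
  have eq: "?f x = theta_energy i T * (\<rho> x * u x * w x)"
    if T: "T \<in> elements (Osub i)" and x: "x \<in> interior T" for T x
  proof -
    have T': "T \<in> \<T>" using T elements_subset by blast
    have "grad (theta j) x = elem_grad T (theta j)" for j
      by (rule grad_eq_elem_grad[OF T' pw_linear_elem_grad(1)[OF theta_props(1) T'] x])
    then show ?thesis
      by (simp add: theta_energy_def)
  qed
  have int: "integrable (lebesgue_on (interior T)) ?f
      \<longleftrightarrow> integrable (lebesgue_on (interior T)) (\<lambda>x. theta_energy i T * (\<rho> x * u x * w x))"
    if "T \<in> elements (Osub i)" for T
    by (rule Bochner_Integration.integrable_cong[OF refl], rule eq[OF that]) simp
  have lint: "(LINT x|lebesgue_on (interior T). ?f x)
      = (LINT x|lebesgue_on (interior T). theta_energy i T * (\<rho> x * u x * w x))"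
    if "T \<in> elements (Osub i)" for T
    by (rule Bochner_Integration.integral_cong[OF refl], rule eq[OF that]) simp
  have "s_sub i u w = (\<Sum>T\<in>elements (Osub i). LINT x|lebesgue_on (interior T). ?f x)"
    unfolding s_sub_def
  proof (rule integral_mesh_region[OF mesh_region_Osub[OF i]])
    fix T assume T: "T \<in> elements (Osub i)"
    have "integrable (lebesgue_on (interior T)) (\<lambda>x. \<rho> x * u x * w x)"
      using T elements_subset by (intro integrable_moment u w) blast+
    then show "integrable (lebesgue_on (interior T)) ?f"
      unfolding int[OF T] by (rule integrable_mult_right)
  qed
  also have "\<dots> = (\<Sum>T\<in>elements (Osub i). theta_energy i T * moment T u w)"
    unfolding moment_def by (intro sum.cong refl) (simp add: lint)
  finally show ?thesis .
qed

lemma moment_sym: "moment T u w = moment T w u"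
  by (simp add: moment_def mult_ac)

lemma moment_add:
  assumes "T \<in> \<T>" "affine_on T u" "affine_on T v" "affine_on T w"
  shows "moment T (u + v) w = moment T u w + moment T v w"
proof -
  have "moment T (u + v) w = (LINT x|lebesgue_on (interior T). \<rho> x * u x * w x + \<rho> x * v x * w x)"
    unfolding moment_def by (simp add: algebra_simps)
  then show ?thesis
    unfolding moment_def using assms by (simp add: integrable_moment)
qed

lemma moment_scale: "moment T (\<lambda>x. c * u x) w = c * moment T u w"
proof -
  have "moment T (\<lambda>x. c * u x) w = (LINT x|lebesgue_on (interior T). c * (\<rho> x * u x * w x))"
    unfolding moment_def by (simp add: algebra_simps)
  then show ?thesis
    by (simp add: moment_def)
qed

lemma s_sub_sym_form:
  assumes i: "i \<in> {1..N}"
  shows "sym_form {u. \<forall>T\<in>elements (Osub i). affine_on T u} (s_sub i)"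
proof -
  let ?X = "{u. \<forall>T\<in>elements (Osub i). affine_on T u}"
  interpret A: sym_form ?X "form_on (Osub i)"
    by (rule form_on_sym_form[OF mesh_region_Osub[OF i]])
  have eq: "s_sub i u w = (\<Sum>T\<in>elements (Osub i). theta_energy i T * moment T u w)"
    if "u \<in> ?X" "w \<in> ?X" for u w
    using s_sub_eq_sum[OF i] that by blast
  show ?thesis
  proof
    show "fun_space.subspace ?X" by (rule A.subspace)
  next
    fix u v assume uv: "u \<in> ?X" "v \<in> ?X"
    show "s_sub i u v = s_sub i v u"
      unfolding eq[OF uv] eq[OF uv(2,1)] by (intro sum.cong refl arg_cong2[where f = times] moment_sym)
    show "s_sub i (\<lambda>x. c * u x) v = c * s_sub i u v" for c
      unfolding eq[OF A.scale_in[OF uv(1)] uv(2)] eq[OF uv] moment_scale sum_distrib_left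
      by (intro sum.cong refl) simp
    fix w assume w: "w \<in> ?X"
    have "moment T (u + v) w = moment T u w + moment T v w" if "T \<in> elements (Osub i)" for T
      using uv w that elements_subset by (intro moment_add) blast+
    then show "s_sub i (u + v) w = s_sub i u w + s_sub i v w"
      unfolding eq[OF A.add_in[OF uv] w] eq[OF uv(1) w] eq[OF uv(2) w]
      by (simp add: distrib_left sum.distrib)
  qed
qed

lemma mesh_size_pos:
  assumes "T \<in> \<T>"
  shows "diameter T \<le> Max (diameter ` \<T>)" "0 < Max (diameter ` \<T>)"
proof -
  show le: "diameter T \<le> Max (diameter ` \<T>)"
    using finite_mesh assms by simp
  have "0 < diameter T"
  proof (rule ccontr)
    assume "\<not> 0 < diameter T"
    then have "x = y" if "x \<in> T" "y \<in> T" for x y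
      using diameter_bounded_bound[of T x y] compact_imp_bounded[OF element_props(2)[OF assms]] that
        zero_less_dist_iff[of x y] by linarith
    moreover obtain z where "z \<in> T"
      using element_props(5)[OF assms] by blast
    ultimately have "T = {z}" by blast
    then show False
      using element_props(4)[OF assms] by simp
  qed
  with le show "0 < Max (diameter ` \<T>)" by simp
qed

text \<open>The gradient on the left is constant on T, so the pointwise bound can be multiplied by
  rho and integrated over T as it stands.\<close>

lemma piece_element_energy:
  assumes w: "w \<in> Vh" and T: "T \<in> \<T>" and "0 < \<sigma>"
    and ball: "ball p r \<subseteq> T" "\<sigma> * Max (diameter ` \<T>) \<le> r"
  shows "weight T * (norm (elem_grad T (piece i w)))\<^sup>2
    \<le> (8 * (norm (elem_grad T w))\<^sup>2 * weight T + 2 * (norm (elem_grad T (theta i)))\<^sup>2 * moment T w w) / \<sigma>\<^sup>2"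
proof -
  let ?M = "lebesgue_on (interior T)"
  let ?A = "norm (elem_grad T w)" and ?B = "norm (elem_grad T (theta i))"
  let ?P = "norm (elem_grad T (piece i w))"
  have node: "y \<in> mesh_nodes \<T>" if "y \<in> vertices T" for y
    using that T by (auto simp: mesh_nodes_eq)
  have pt: "?P\<^sup>2 \<le> (8 * ?A\<^sup>2 + 2 * ?B\<^sup>2 * (w x * w x)) / \<sigma>\<^sup>2" if x: "x \<in> T" for x
  proof -
    have "?P \<le> (2 * ?A + ?B * \<bar>w x\<bar>) / \<sigma>"
      using mesh_size_pos[OF T] node theta_range piece_props(2) ball \<open>0 < \<sigma>\<close> x
      by (intro interpolated_product_gradient[OF T ball(1) _ _ ball(2) _ theta_props(1) Vh_pw_linear[OF w] piece_props(1)]) auto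
    then have "?P\<^sup>2 \<le> ((2 * ?A + ?B * \<bar>w x\<bar>) / \<sigma>)\<^sup>2"
      by (rule power_mono) simp
    also have "\<dots> = (2 * ?A + ?B * \<bar>w x\<bar>)\<^sup>2 / \<sigma>\<^sup>2"
      by (rule power_divide)
    \<comment> \<open>From (s + t)^2 <= 2 s^2 + 2 t^2 with s = 2 |grad w|.\<close>
    also have "(2 * ?A + ?B * \<bar>w x\<bar>)\<^sup>2 \<le> 2 * (2 * ?A)\<^sup>2 + 2 * (?B * \<bar>w x\<bar>)\<^sup>2"
      using sum_squares_bound[of "2 * ?A" "?B * \<bar>w x\<bar>"] by (simp add: power2_sum)
    also have "\<dots> = 8 * ?A\<^sup>2 + 2 * ?B\<^sup>2 * (w x * w x)"
      by (simp add: power_mult_distrib power2_eq_square)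
    finally show ?thesis
      by (simp add: divide_right_mono)
  qed
  have int1: "integrable ?M \<rho>" and int2: "integrable ?M (\<lambda>x. \<rho> x * w x * w x)"
    using coeff_integrable_element integrable_moment Vh_affine_on[OF w T] T by blast+
  have split: "\<rho> x * ((8 * ?A\<^sup>2 + 2 * ?B\<^sup>2 * (w x * w x)) / \<sigma>\<^sup>2)
      = (8 * ?A\<^sup>2 / \<sigma>\<^sup>2) * \<rho> x + (2 * ?B\<^sup>2 / \<sigma>\<^sup>2) * (\<rho> x * w x * w x)" for x
    by (simp add: add_divide_distrib algebra_simps)
  have "weight T * ?P\<^sup>2 = (LINT x|?M. \<rho> x * ?P\<^sup>2)"
    by (simp add: weight_def)
  also have "\<dots> \<le> (LINT x|?M. (8 * ?A\<^sup>2 / \<sigma>\<^sup>2) * \<rho> x + (2 * ?B\<^sup>2 / \<sigma>\<^sup>2) * (\<rho> x * w x * w x))"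
  proof (rule integral_mono_AE)
    show "integrable ?M (\<lambda>x. \<rho> x * ?P\<^sup>2)"
      using int1 by simp
    show "integrable ?M (\<lambda>x. (8 * ?A\<^sup>2 / \<sigma>\<^sup>2) * \<rho> x + (2 * ?B\<^sup>2 / \<sigma>\<^sup>2) * (\<rho> x * w x * w x))"
      using int1 int2 by (intro Bochner_Integration.integrable_add integrable_mult_right)
    have "AE x in ?M. x \<in> T"
      by (rule AE_I2) (use interior_subset in auto)
    with coeff_pos_element[OF T]
    show "AE x in ?M. \<rho> x * ?P\<^sup>2 \<le> (8 * ?A\<^sup>2 / \<sigma>\<^sup>2) * \<rho> x + (2 * ?B\<^sup>2 / \<sigma>\<^sup>2) * (\<rho> x * w x * w x)"
      unfolding split[symmetric] by eventually_elim (rule mult_left_mono[OF pt], simp_all)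
  qed
  also have "\<dots> = (8 * ?A\<^sup>2 / \<sigma>\<^sup>2) * weight T + (2 * ?B\<^sup>2 / \<sigma>\<^sup>2) * moment T w w"
    using int1 int2 by (simp add: weight_def moment_def)
  finally show ?thesis
    by (simp add: add_divide_distrib)
qed

text \<open>Each T lies in exactly one subdomain i. A piece j that is not constant on T needs T in
  \<open>Oext j\<close>; since T is also in \<open>Oext i\<close>, j is a neighbour of i. So the
  gradients of the partition of unity are summed over the very index set built into
  \<open>s_sub i\<close>.\<close>

lemma pieces_energy:
  assumes w: "w \<in> Vh" and "0 < \<sigma>"
    and shape: "\<And>T. T \<in> \<T> \<Longrightarrow> \<exists>p r. ball p r \<subseteq> T \<and> \<sigma> * Max (diameter ` \<T>) \<le> r"
  shows "(\<Sum>j=1..N. a (piece j w) (piece j w))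
    \<le> (\<Sum>i=1..N. (8 * real overlap_number * a_sub i w w + 2 * s_sub i w w) / \<sigma>\<^sup>2)"
proof -
  let ?E = "\<lambda>i. elements (Osub i)"
  let ?P = "\<lambda>j T. weight T * (norm (elem_grad T (piece j w)))\<^sup>2"
  have el: "T \<in> \<T>" if "T \<in> ?E i" for T i
    using that elements_subset by blast
  have V: "piece j w \<in> Vh" if "j \<in> {1..N}" for j
    using piece_in_Vloc[OF that w] Vloc_subset by blast
  have local: "(\<Sum>j=1..N. ?P j T)
      \<le> (8 * real overlap_number * (weight T * (norm (elem_grad T w))\<^sup>2)
          + 2 * (theta_energy i T * moment T w w)) / \<sigma>\<^sup>2"
    if i: "i \<in> {1..N}" and T: "T \<in> ?E i" for i T
  proof -
    have zero: "?P j T = 0" if j: "j \<in> {1..N} - neighbours i" for j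
    proof -
      have "T \<notin> elements (Oext j)"
      proof
        assume "T \<in> elements (Oext j)"
        then have "interior T \<subseteq> Oext j \<inter> Oext i"
          using T Osub_subset_Oext[OF i] by (auto simp: elements_def)
        then have "Oext j \<inter> Oext i \<noteq> {}"
          using element_props(4)[OF el[OF T]] by blast
        then show False
          using j unfolding neighbours_def by blast
      qed
      then have "elem_grad T (piece j w) = 0"
        using j piece_in_Vloc[OF _ w] el[OF T] by (intro Vloc_elem_grad_zero) auto
      then show ?thesis by simp
    qed
    obtain p r where pr: "ball p r \<subseteq> T" "\<sigma> * Max (diameter ` \<T>) \<le> r"
      using shape[OF el[OF T]] by blast
    have nb: "neighbours i \<subseteq> {1..N}"
      by (auto simp: neighbours_def)
    have "(\<Sum>j=1..N. ?P j T) = (\<Sum>j\<in>neighbours i. ?P j T)"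
      using zero nb by (intro sum.mono_neutral_right) auto
    also have "\<dots> \<le> (\<Sum>j\<in>neighbours i. (8 * (norm (elem_grad T w))\<^sup>2 * weight T
        + 2 * (norm (elem_grad T (theta j)))\<^sup>2 * moment T w w) / \<sigma>\<^sup>2)"
      by (intro sum_mono piece_element_energy[OF w el[OF T] \<open>0 < \<sigma>\<close> pr])
    also have "\<dots> = (8 * real (card (neighbours i)) * (weight T * (norm (elem_grad T w))\<^sup>2)
        + 2 * (theta_energy i T * moment T w w)) / \<sigma>\<^sup>2"
      unfolding theta_energy_def sum_divide_distrib[symmetric]
      by (simp add: sum.distrib sum_distrib_left sum_distrib_right algebra_simps)
    also have "\<dots> \<le> (8 * real overlap_number * (weight T * (norm (elem_grad T w))\<^sup>2)
        + 2 * (theta_energy i T * moment T w w)) / \<sigma>\<^sup>2"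
      using card_neighbours_le[OF i] weight_pos[OF el[OF T]]
      by (intro divide_right_mono add_right_mono mult_right_mono) auto
    finally show ?thesis .
  qed
  have aff: "affine_on T w" if "T \<in> ?E i" for T i
    using Vh_affine_on[OF w el[OF that]] .
  have "(\<Sum>j=1..N. a (piece j w) (piece j w)) = (\<Sum>j=1..N. \<Sum>T\<in>\<T>. ?P j T)"
    using V by (intro sum.cong refl) (simp add: a_eq_sum power2_norm_eq_inner)
  also have "\<dots> = (\<Sum>T\<in>\<T>. \<Sum>j=1..N. ?P j T)"
    by (rule sum.swap)
  also have "\<dots> = (\<Sum>i=1..N. \<Sum>T\<in>?E i. \<Sum>j=1..N. ?P j T)"
    by (rule sum_elements)
  also have "\<dots> \<le> (\<Sum>i=1..N. \<Sum>T\<in>?E i. (8 * real overlap_number * (weight T * (norm (elem_grad T w))\<^sup>2)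
          + 2 * (theta_energy i T * moment T w w)) / \<sigma>\<^sup>2)"
    by (intro sum_mono local)
  also have "\<dots> = (\<Sum>i=1..N. (8 * real overlap_number * a_sub i w w + 2 * s_sub i w w) / \<sigma>\<^sup>2)"
  proof (rule sum.cong[OF refl])
    fix i assume i: "i \<in> {1..N}"
    have "a_sub i w w = (\<Sum>T\<in>?E i. weight T * (norm (elem_grad T w))\<^sup>2)"
      unfolding a_sub_def power2_norm_eq_inner
      by (rule form_on_eq_sum[OF mesh_region_Osub[OF i] aff aff])
    moreover have "s_sub i w w = (\<Sum>T\<in>?E i. theta_energy i T * moment T w w)"
      by (rule s_sub_eq_sum[OF i aff aff])
    ultimately show "(\<Sum>T\<in>?E i. (8 * real overlap_number * (weight T * (norm (elem_grad T w))\<^sup>2)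
          + 2 * (theta_energy i T * moment T w w)) / \<sigma>\<^sup>2)
        = (8 * real overlap_number * a_sub i w w + 2 * s_sub i w w) / \<sigma>\<^sup>2"
      by (simp add: sum.distrib sum_distrib_left sum_divide_distrib[symmetric])
  qed
  finally show ?thesis .
qed

lemma sum_a_sub:
  assumes w: "w \<in> Vh"
  shows "(\<Sum>i=1..N. a_sub i w w) = a w w"
proof -
  have aff: "affine_on T w" if "T \<in> elements (Osub i)" for T i
    using Vh_affine_on[OF w] that elements_subset by blast
  have "(\<Sum>i=1..N. a_sub i w w)
      = (\<Sum>i=1..N. \<Sum>T\<in>elements (Osub i). weight T * inner (elem_grad T w) (elem_grad T w))"
    unfolding a_sub_def by (intro sum.cong refl form_on_eq_sum mesh_region_Osub aff)
  then show ?thesis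
    unfolding a_eq_sum[OF w w] sum_elements .
qed

end

section \<open>The auxiliary and coarse spaces\<close>

text \<open>A vector of V outside the span of B would extend B to an independent set larger than a
  basis D of V. The set C makes D finite, so that the exchange bound applies.\<close>

lemma span_of_maximal_independent:
  fixes V :: "('a \<Rightarrow> real) set"
  assumes B: "fun_space.independent B" "B \<subseteq> V" "finite B" "card B = fun_space.dim V"
    and C: "finite C" "V \<subseteq> fun_space.span C"
  shows "V \<subseteq> fun_space.span B"
proof (rule subsetI, rule ccontr)
  fix v assume v: "v \<in> V" "v \<notin> fun_space.span B"
  obtain D where D: "D \<subseteq> V" "fun_space.independent D" "V \<subseteq> fun_space.span D"
      "card D = fun_space.dim V"
    by (rule fun_space.basis_exists)
  have "D \<subseteq> fun_space.span C"
    using D(1) C(2) by (rule subset_trans)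
  then have "finite D"
    using conjunct1[OF fun_space.independent_span_bound[OF C(1) D(2)]] by blast
  moreover have "fun_space.independent (insert v B)"
    using B(1) v(2) by (simp add: fun_space.independent_insert)
  moreover have "insert v B \<subseteq> fun_space.span D"
    using v(1) B(2) D(3) by blast
  ultimately have "card (insert v B) \<le> card D"
    using fun_space.independent_span_bound by metis
  moreover have "v \<notin> B"
    using v(2) fun_space.span_base by metis
  ultimately show False
    using B(3,4) D(4) by simp
qed

context overlapping_decomposition
begin

definition restriction :: "nat \<Rightarrow> ('a \<Rightarrow> real) \<Rightarrow> 'a \<Rightarrow> real" where
  "restriction i u = (\<lambda>x. if x \<in> closure (Osub i) then u x else 0)"

lemma Vsub_eq: "Vsub i = restriction i ` Vh"
  by (simp add: Vsub_def restriction_def)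

lemma restriction_interior:
  assumes "T \<in> elements (Osub i)" "x \<in> interior T"
  shows "restriction i u x = u x"
  using assms closure_subset[of "Osub i"] unfolding restriction_def elements_def by auto

lemma restriction_affine:
  assumes "u \<in> Vh" "T \<in> elements (Osub i)"
  shows "affine_on T (restriction i u)" "elem_grad T (restriction i u) = elem_grad T u"
proof -
  have T: "T \<in> \<T>" using assms(2) elements_subset by blast
  show "affine_on T (restriction i u)" "elem_grad T (restriction i u) = elem_grad T u"
    using elem_grad_cong[OF T Vh_affine_on[OF assms(1) T]] restriction_interior[OF assms(2)] by blast+
qed

lemma Vsub_affine: "\<lbrakk>u \<in> Vsub i; T \<in> elements (Osub i)\<rbrakk> \<Longrightarrow> affine_on T u"
  unfolding Vsub_eq using restriction_affine(1) by blast

lemma Vsub_finite_dim: "\<exists>C. finite C \<and> Vsub i \<subseteq> fun_space.span C"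
proof -
  obtain B where B: "finite B" "Vh \<subseteq> fun_space.span B"
    using Vh_finite_dim by (elim exE conjE)
  let ?C = "restriction i ` B"
  have "restriction i u \<in> fun_space.span ?C" if "u \<in> fun_space.span B" for u
    using that
  proof (induction rule: fun_space.span_induct_alt)
    case base
    have "restriction i 0 = 0"
      by (auto simp: restriction_def)
    then show ?case
      using fun_space.span_zero[of ?C] by metis
  next
    case (step c u v)
    have eq: "restriction i ((\<lambda>x. c * u x) + v) = (\<lambda>x. c * restriction i u x) + restriction i v"
      by (auto simp: restriction_def)
    have "restriction i u \<in> fun_space.span ?C"
      using step(1) by (intro fun_space.span_base imageI)
    then show ?case
      unfolding eq by (rule fun_space.span_add[OF fun_space.span_scale step(2)])
  qed
  then have "Vsub i \<subseteq> fun_space.span ?C"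
    unfolding Vsub_eq using B(2) by blast
  with B(1) show ?thesis
    by (intro exI[of _ ?C] conjI finite_imageI)
qed

end

context two_level_schwarz
begin

text \<open>On this space, which contains both \<open>Vh\<close> and \<open>Vsub i\<close>, the local forms are bilinear.\<close>
definition Xsub :: "nat \<Rightarrow> ('a \<Rightarrow> real) set" where
  "Xsub i = {u. \<forall>T\<in>elements (Osub i). affine_on T u}"

lemma Vh_Xsub: "Vh \<subseteq> Xsub i"
  using Vh_affine_on elements_subset by (auto simp: Xsub_def)

lemma Vsub_Xsub: "Vsub i \<subseteq> Xsub i"
  using Vsub_affine by (auto simp: Xsub_def)

lemma eigenfunction_Xsub: "\<lbrakk>i \<in> {1..N}; j \<in> {1..n_sub i}\<rbrakk> \<Longrightarrow> \<phi> i j \<in> Xsub i"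
  using eigenfunction Vsub_Xsub by blast

lemma s_form: "i \<in> {1..N} \<Longrightarrow> sym_form (Xsub i) (s_sub i)"
  unfolding Xsub_def by (rule s_sub_sym_form)

lemma a_form: "i \<in> {1..N} \<Longrightarrow> sym_form (Xsub i) (a_sub i)"
  unfolding Xsub_def a_sub_def by (intro form_on_sym_form mesh_region_Osub)

lemma Vaux_Xsub:
  assumes i: "i \<in> {1..N}"
  shows "Vaux i \<subseteq> Xsub i"
  unfolding Vaux_def
proof (rule fun_space.span_minimal)
  show "\<phi> i ` {1..l i} \<subseteq> Xsub i"
    using eigenfunction_Xsub[OF i] l_le[OF i] by auto
qed (rule sym_form.subspace[OF s_form[OF i]])

section \<open>The eigenfunctions as a basis of the local space\<close>

lemma s_orthonormal:
  assumes "i \<in> {1..N}" "j \<in> {1..n_sub i}" "j' \<in> {1..n_sub i}"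
  shows "s_sub i (\<phi> i j) (\<phi> i j') = (if j = j' then 1 else 0)"
  using orthogonal[OF assms] normalized[OF assms(1,2)] by auto

lemma eigenfunctions_inj:
  assumes i: "i \<in> {1..N}"
  shows "inj_on (\<phi> i) {1..n_sub i}"
proof (rule inj_onI, rule ccontr)
  fix j j' assume j: "j \<in> {1..n_sub i}" "j' \<in> {1..n_sub i}" "\<phi> i j = \<phi> i j'" "j \<noteq> j'"
  then show False
    using s_orthonormal[OF i j(1,2)] normalized[OF i j(2)] by simp
qed

text \<open>Pairing with one eigenfunction in \<open>s_sub i\<close> annihilates the span of all the
  others, but gives 1 on that eigenfunction itself.\<close>

lemma eigenfunctions_independent:
  assumes i: "i \<in> {1..N}"
  shows "fun_space.independent (\<phi> i ` {1..n_sub i})"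
proof
  interpret S: sym_form "Xsub i" "s_sub i" by (rule s_form[OF i])
  assume "fun_space.dependent (\<phi> i ` {1..n_sub i})"
  then obtain e where e: "e \<in> \<phi> i ` {1..n_sub i}"
      "e \<in> fun_space.span (\<phi> i ` {1..n_sub i} - {e})"
    unfolding fun_space.dependent_def by (elim bexE)
  obtain j where j: "j \<in> {1..n_sub i}" "e = \<phi> i j"
    using e(1) by blast
  note eX = eigenfunction_Xsub[OF i j(1)]
  \<comment> \<open>Membership in \<open>Xsub i\<close> is carried through the induction because
    additivity of \<open>s_sub i\<close> is known only there.\<close>
  from e(2) have "e \<in> Xsub i \<and> s_sub i e (\<phi> i j) = 0"
  proof (induction rule: fun_space.span_induct_alt)
    case base
    show ?case
      using S.zero_in S.zero_left[OF eX] by (rule conjI)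
  next
    case (step c u v)
    from step(1) obtain j' where j': "j' \<in> {1..n_sub i}" "u = \<phi> i j'" "u \<noteq> e"
      by blast
    have u: "u \<in> Xsub i" "s_sub i u (\<phi> i j) = 0"
      using eigenfunction_Xsub[OF i j'(1)] s_orthonormal[OF i j'(1) j(1)] j' j(2) by auto
    have v: "v \<in> Xsub i" "s_sub i v (\<phi> i j) = 0"
      using step(2) by blast+
    have "s_sub i ((\<lambda>x. c * u x) + v) (\<phi> i j) = 0"
      unfolding S.add_left[OF S.scale_in[OF u(1)] v(1) eX] S.scale_left[OF u(1) eX] u(2) v(2) by simp
    with S.add_in[OF S.scale_in[OF u(1)] v(1)] show ?case
      by (rule conjI)
  qed
  then show False
    using normalized[OF i j(1)] j(2) by simp
qed

text \<open>Completeness by counting: the independent eigenfunctions are as many as the dimension of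
  \<open>Vsub i\<close>.\<close>

lemma Vsub_span:
  assumes i: "i \<in> {1..N}"
  shows "Vsub i \<subseteq> fun_space.span (\<phi> i ` {1..n_sub i})"
proof -
  obtain C where C: "finite C" "Vsub i \<subseteq> fun_space.span C"
    using Vsub_finite_dim[of i] by (elim exE conjE)
  show ?thesis
  proof (rule span_of_maximal_independent[OF eigenfunctions_independent[OF i] _ _ _ C])
    show "\<phi> i ` {1..n_sub i} \<subseteq> Vsub i"
      using eigenfunction[OF i] by blast
    show "card (\<phi> i ` {1..n_sub i}) = fun_space.dim (Vsub i)"
      using card_image[OF eigenfunctions_inj[OF i]] by (simp add: n_sub_def)
  qed simp
qed

text \<open>Parseval in the s-orthonormal expansion with coefficients \<open>c j\<close> gives
  s(r,r) as the sum of \<open>(c j)\<^sup>2\<close>, and the eigenvalue equation tested with r gives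
  a(r,r) as the sum of \<open>(c j)\<^sup>2 / ev i j\<close>. Orthogonality removes the selected
  indices, and for the others \<open>ev i j\<close> is below \<Lambda>.\<close>

lemma local_spectral_bound:
  assumes i: "i \<in> {1..N}" and r: "r \<in> Vsub i"
    and orth: "\<And>j. j \<in> {1..l i} \<Longrightarrow> s_sub i r (\<phi> i j) = 0"
  shows "s_sub i r r \<le> \<Lambda> * a_sub i r r"
proof -
  interpret S: sym_form "Xsub i" "s_sub i" by (rule s_form[OF i])
  interpret A: sym_form "Xsub i" "a_sub i" by (rule a_form[OF i])
  let ?J = "{1..n_sub i}"
  have rX: "r \<in> Xsub i"
    using r Vsub_Xsub by blast
  note \<phi>X = eigenfunction_Xsub[OF i]
  have "r \<in> range (\<lambda>c. \<Sum>e\<in>\<phi> i ` ?J. (\<lambda>x. c e * e x))"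
    using r Vsub_span[OF i] unfolding fun_space.span_finite[OF finite_imageI[OF finite_atLeastAtMost]]
    by (rule subsetD[rotated])
  then obtain c' where c': "r = (\<Sum>e\<in>\<phi> i ` ?J. (\<lambda>x. c' e * e x))"
    by (elim imageE)
  define c where "c j = c' (\<phi> i j)" for j
  have r_eq: "r = (\<Sum>j\<in>?J. (\<lambda>x. c j * \<phi> i j x))"
    unfolding c' c_def by (simp only: sum.reindex[OF eigenfunctions_inj[OF i]] o_def)
  have s_coeff: "s_sub i (\<phi> i j) r = c j" if j: "j \<in> ?J" for j
  proof -
    have "s_sub i (\<phi> i j) r = (\<Sum>j'\<in>?J. s_sub i (\<phi> i j) (\<lambda>x. c j' * \<phi> i j' x))"
      unfolding r_eq by (rule S.sum_right[OF S.scale_in[OF \<phi>X] \<phi>X[OF j]])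
    also have "\<dots> = (\<Sum>j'\<in>?J. if j' = j then c j else 0)"
    proof (rule sum.cong[OF refl])
      fix j' assume j': "j' \<in> ?J"
      show "s_sub i (\<phi> i j) (\<lambda>x. c j' * \<phi> i j' x) = (if j' = j then c j else 0)"
        unfolding S.scale_right[OF \<phi>X[OF j'] \<phi>X[OF j]] s_orthonormal[OF i j j'] by simp
    qed
    also have "\<dots> = c j"
      using j by simp
    finally show ?thesis .
  qed
  have a_coeff: "a_sub i (\<phi> i j) r = c j / ev i j" if j: "j \<in> ?J" for j
    using eigenpair[OF i j r] s_coeff[OF j] ev_pos[OF i j] by (simp add: field_simps)
  have "s_sub i r r = (\<Sum>j\<in>?J. s_sub i (\<lambda>x. c j * \<phi> i j x) r)"
    using S.sum_left[OF S.scale_in[OF \<phi>X] rX, of ?J "\<lambda>j. j" c] unfolding r_eq[symmetric] .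
  also have "\<dots> = (\<Sum>j\<in>?J. (c j)\<^sup>2)"
    using S.scale_left[OF \<phi>X rX] s_coeff by (intro sum.cong refl) (simp add: power2_eq_square)
  also have "\<dots> \<le> (\<Sum>j\<in>?J. \<Lambda> * ((c j)\<^sup>2 / ev i j))"
  proof (rule sum_mono)
    fix j assume j: "j \<in> ?J"
    show "(c j)\<^sup>2 \<le> \<Lambda> * ((c j)\<^sup>2 / ev i j)"
    proof (cases "j \<le> l i")
      case True
      then have "c j = 0"
        using s_coeff[OF j] orth[of j] S.sym[OF rX \<phi>X[OF j]] j by simp
      then show ?thesis by simp
    next
      case False
      then have "ev i j * (c j)\<^sup>2 \<le> \<Lambda> * (c j)\<^sup>2"
        using ev_small[OF i, of j] j by (intro mult_right_mono) auto
      then show ?thesis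
        using ev_pos[OF i j] by (simp add: field_simps)
    qed
  qed
  also have "\<dots> = \<Lambda> * (\<Sum>j\<in>?J. a_sub i (\<lambda>x. c j * \<phi> i j x) r)"
    unfolding sum_distrib_left using A.scale_left[OF \<phi>X rX] a_coeff
    by (intro sum.cong refl) (simp add: power2_eq_square)
  also have "(\<Sum>j\<in>?J. a_sub i (\<lambda>x. c j * \<phi> i j x) r) = a_sub i r r"
    using A.sum_left[OF A.scale_in[OF \<phi>X] rX, of ?J "\<lambda>j. j" c] unfolding r_eq[symmetric] by (rule sym)
  finally show ?thesis .
qed

section \<open>The constrained space and its energy complement\<close>

lemma Vtilde_subset: "Vtilde \<subseteq> Vh"
  by (auto simp: Vtilde_def)

text \<open>The eigenfunctions expand elements of \<open>Vsub i\<close>, which vanish off the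
  subdomain, and v need not. Its restriction does, and the forms, integrating over
  \<open>Osub i\<close>, do not see the change.\<close>

lemma Vtilde_spectral_bound:
  assumes i: "i \<in> {1..N}" and v: "v \<in> Vtilde"
  shows "s_sub i v v \<le> \<Lambda> * a_sub i v v"
proof -
  let ?r = "restriction i v"
  have vV: "v \<in> Vh"
    using v Vtilde_subset by blast
  have rV: "?r \<in> Vsub i"
    using vV by (simp add: Vsub_eq)
  have aff: "affine_on T v" "affine_on T ?r" if "T \<in> elements (Osub i)" for T
    using Vh_affine_on[OF vV] restriction_affine(1)[OF vV that] that elements_subset by blast+
  have moment: "moment T ?r w = moment T v w" if T: "T \<in> elements (Osub i)" for T w
    unfolding moment_def
    by (rule Bochner_Integration.integral_cong[OF refl]) (simp add: restriction_interior[OF T])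
  have s_eq: "s_sub i ?r w = s_sub i v w" if "w \<in> Xsub i" for w
  proof -
    have w: "affine_on T w" if "T \<in> elements (Osub i)" for T
      using \<open>w \<in> Xsub i\<close> that by (simp add: Xsub_def)
    have "s_sub i ?r w = (\<Sum>T\<in>elements (Osub i). theta_energy i T * moment T ?r w)"
      by (rule s_sub_eq_sum[OF i aff(2) w])
    also have "\<dots> = (\<Sum>T\<in>elements (Osub i). theta_energy i T * moment T v w)"
      by (intro sum.cong refl) (simp add: moment)
    also have "\<dots> = s_sub i v w"
      by (rule s_sub_eq_sum[OF i aff(1) w, symmetric])
    finally show ?thesis .
  qed
  have "a_sub i ?r ?r = a_sub i v v"
  proof -
    have "a_sub i ?r ?r
        = (\<Sum>T\<in>elements (Osub i). weight T * inner (elem_grad T ?r) (elem_grad T ?r))"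
      unfolding a_sub_def by (rule form_on_eq_sum[OF mesh_region_Osub[OF i] aff(2) aff(2)])
    also have "\<dots> = (\<Sum>T\<in>elements (Osub i). weight T * inner (elem_grad T v) (elem_grad T v))"
      by (intro sum.cong refl) (simp add: restriction_affine(2)[OF vV])
    also have "\<dots> = a_sub i v v"
      unfolding a_sub_def by (rule form_on_eq_sum[OF mesh_region_Osub[OF i] aff(1) aff(1), symmetric])
    finally show ?thesis .
  qed
  moreover have "s_sub i ?r ?r = s_sub i v v"
  proof -
    \<comment> \<open>\<open>s_eq\<close> replaces the first argument only; symmetry brings the
      second one to the front.\<close>
    have "s_sub i ?r ?r = s_sub i v ?r"
      using rV Vsub_Xsub by (intro s_eq) blast
    also have "\<dots> = s_sub i ?r v"
      using sym_form.sym[OF s_form[OF i], of v ?r] vV Vh_Xsub rV Vsub_Xsub by blast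
    also have "\<dots> = s_sub i v v"
      using vV Vh_Xsub by (intro s_eq) blast
    finally show ?thesis .
  qed
  moreover have "s_sub i ?r ?r \<le> \<Lambda> * a_sub i ?r ?r"
  proof (rule local_spectral_bound[OF i rV])
    fix j assume j: "j \<in> {1..l i}"
    have "\<phi> i j \<in> Vaux i"
      unfolding Vaux_def using j by (intro fun_space.span_base imageI)
    moreover have "\<phi> i j \<in> Xsub i"
      using j l_le[OF i] by (intro eigenfunction_Xsub[OF i]) simp
    ultimately show "s_sub i ?r (\<phi> i j) = 0"
      using v i s_eq unfolding Vtilde_def by simp
  qed
  ultimately show ?thesis by simp
qed

lemma subspace_Vtilde: "fun_space.subspace Vtilde"
proof (rule fun_space.subspaceI)
  have "s_sub i 0 w = 0" if "i \<in> {1..N}" "w \<in> Vaux i" for i w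
    using sym_form.zero_left[OF s_form[OF that(1)]] Vaux_Xsub[OF that(1)] that(2) by blast
  then show "0 \<in> Vtilde"
    using energy.zero_in unfolding Vtilde_def by blast
next
  fix u v assume uv: "u \<in> Vtilde" "v \<in> Vtilde"
  have "s_sub i (u + v) w = 0" if i: "i \<in> {1..N}" and w: "w \<in> Vaux i" for i w
  proof -
    have "s_sub i (u + v) w = s_sub i u w + s_sub i v w"
      using uv w Vtilde_subset Vh_Xsub Vaux_Xsub[OF i] by (intro sym_form.add_left[OF s_form[OF i]]) blast+
    then show ?thesis
      using uv i w by (simp add: Vtilde_def)
  qed
  then show "u + v \<in> Vtilde"
    using energy.add_in[of u v] uv by (simp add: Vtilde_def)
next
  fix c u assume u: "u \<in> Vtilde"
  have "s_sub i (\<lambda>x. c * u x) w = 0" if i: "i \<in> {1..N}" and w: "w \<in> Vaux i" for i w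
  proof -
    have "s_sub i (\<lambda>x. c * u x) w = c * s_sub i u w"
      using u w Vtilde_subset Vh_Xsub Vaux_Xsub[OF i] by (intro sym_form.scale_left[OF s_form[OF i]]) blast+
    then show ?thesis
      using u i w by (simp add: Vtilde_def)
  qed
  then show "(\<lambda>x. c * u x) \<in> Vtilde"
    using energy.scale_in[of u c] u by (simp add: Vtilde_def)
qed

lemma Vcoarse_subset: "Vcoarse \<subseteq> Vh"
  by (auto simp: Vcoarse_def)

lemma subspace_Vcoarse: "fun_space.subspace Vcoarse"
proof (rule fun_space.subspaceI)
  show "0 \<in> Vcoarse"
    using energy.zero_in energy.zero_left Vtilde_subset by (auto simp: Vcoarse_def)
next
  fix u v assume uv: "u \<in> Vcoarse" "v \<in> Vcoarse"
  then show "u + v \<in> Vcoarse"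
    using energy.add_in[of u v] energy.add_left[of u v] Vtilde_subset by (auto simp: Vcoarse_def)
next
  fix c u assume u: "u \<in> Vcoarse"
  then show "(\<lambda>x. c * u x) \<in> Vcoarse"
    using energy.scale_in[of u c] energy.scale_left[of u _ c] Vtilde_subset by (auto simp: Vcoarse_def)
qed

section \<open>Spectral bounds for the preconditioned operator\<close>

lemma inner_form_ip: "inner_form Vh ip"
  using subspace_Vh ip_sym ip_add ip_scale ip_pos Vh_finite_dim by unfold_locales

sublocale ipV: inner_form Vh ip
  by (rule inner_form_ip)

lemma Ah_props:
  assumes "u \<in> Vh"
  shows "Ah u \<in> Vh" "\<And>v. v \<in> Vh \<Longrightarrow> ip (Ah u) v = a u v"
  using ipV.riesz_rep_props[OF energy.linear_functional_on_form[OF assms]]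
  by (simp_all add: Ah_def form_operator_def)

text \<open>For v in W the pairings chain up: b(p,v) = ip(\<open>Ah u\<close>, v) = a(u,v). The
  choice of \<open>ip\<close> thus drops out, and each term of the preconditioned operator is an
  energy projection. Agreement of b with a is asked on W only, since the local forms integrate over
  \<open>Oext j\<close>.\<close>

lemma correction_is_projection:
  assumes W: "fun_space.subspace W" "W \<subseteq> Vh"
    and b: "\<And>v w. \<lbrakk>v \<in> W; w \<in> W\<rbrakk> \<Longrightarrow> b v w = a v w" and u: "u \<in> Vh"
  shows "subspace_correction ip W (form_operator ip W b) (Ah u) \<in> W" (is "?p \<in> W")
    and "\<And>v. v \<in> W \<Longrightarrow> a (subspace_correction ip W (form_operator ip W b) (Ah u)) v = a u v"
proof -
  interpret A: inner_form W a
    by (rule energy.mono_inner[OF W])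
  have bW: "inner_form W b"
  proof
    fix x y z and c :: real assume x: "x \<in> W" and y: "y \<in> W"
    show "b x y = b y x"
      using b[OF x y] b[OF y x] A.sym[OF x y] by simp
    show "b (\<lambda>t. c * x t) y = c * b x y"
      using b[OF A.scale_in[OF x] y] b[OF x y] A.scale_left[OF x y] by simp
    assume z: "z \<in> W"
    show "b (x + y) z = b x z + b y z"
      using b[OF A.add_in[OF x y] z] b[OF x z] b[OF y z] A.add_left[OF x y z] by simp
  next
    fix x assume "x \<in> W" "x \<noteq> 0"
    then show "0 < b x x"
      using A.pos b by simp
  qed (rule A.subspace A.finite_dim)+
  have lin: "linear_functional_on W (ip (Ah u))"
    by (rule linear_functional_on_subset[OF ipV.linear_functional_on_form[OF Ah_props(1)[OF u]] W(2)])
  note P = subspace_correction_props[OF ipV.mono_inner[OF W] bW lin]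
  show p: "?p \<in> W" by (rule P(1))
  fix v assume v: "v \<in> W"
  show "a ?p v = a u v"
    using P(2)[OF v] b[OF p v] Ah_props(2)[OF u] W(2) v by auto
qed

definition proj :: "nat \<Rightarrow> ('a \<Rightarrow> real) \<Rightarrow> 'a \<Rightarrow> real" where
  "proj j u = subspace_correction ip (Vloc j) (Aloc j) (Ah u)"

definition proj_coarse :: "('a \<Rightarrow> real) \<Rightarrow> 'a \<Rightarrow> real" where
  "proj_coarse u = subspace_correction ip Vcoarse Acoarse (Ah u)"

lemma proj_props:
  assumes "j \<in> {1..N}" "u \<in> Vh"
  shows "proj j u \<in> Vloc j" "\<And>v. v \<in> Vloc j \<Longrightarrow> a (proj j u) v = a u v"
  using correction_is_projection[OF subspace_Vloc Vloc_subset form_on_Oext[OF assms(1)] assms(2)]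
  by (simp_all add: proj_def Aloc_def)

lemma proj_coarse_props:
  assumes "u \<in> Vh"
  shows "proj_coarse u \<in> Vcoarse" "\<And>v. v \<in> Vcoarse \<Longrightarrow> a (proj_coarse u) v = a u v"
  using correction_is_projection[OF subspace_Vcoarse Vcoarse_subset refl assms]
  by (simp_all add: proj_coarse_def Acoarse_def)

lemma B_inv_Ah: "B_inv (Ah u) = (\<Sum>j=1..N. proj j u) + proj_coarse u"
  by (simp only: B_inv_def proj_def proj_coarse_def)

text \<open>Let P be the sum of the local projections. Then a(u,P) is the sum of their energies, so
  the overlap bound reads a(P,P) <= M a(u,P), whence a(u,P) <= M a(u,u). The coarse projection adds
  at most a(u,u).\<close>

lemma upper_bound:
  assumes u: "u \<in> Vh"
  shows "a u (B_inv (Ah u)) \<le> (real overlap_number + 1) * a u u"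
proof -
  let ?P = "\<Sum>j=1..N. proj j u" and ?q = "proj_coarse u" and ?M = "real overlap_number"
  have pL: "proj j u \<in> Vloc j" if "j \<in> {1..N}" for j
    by (rule proj_props(1)[OF that u])
  have pV: "proj j u \<in> Vh" if "j \<in> {1..N}" for j
    using pL[OF that] Vloc_subset by blast
  have PV: "?P \<in> Vh"
    using pV by (rule energy.sum_in)
  have qV: "?q \<in> Vh"
    using proj_coarse_props(1)[OF u] Vcoarse_subset by blast
  have "a u ?P = (\<Sum>j=1..N. a u (proj j u))"
    by (rule energy.sum_right[OF pV u])
  also have "\<dots> = (\<Sum>j=1..N. a (proj j u) (proj j u))"
    using proj_props(2)[OF _ u pL] by (intro sum.cong refl) simp
  finally have PP: "a ?P ?P \<le> ?M * a u ?P"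
    using energy_sum_Vloc_le[OF pL] by simp
  have "a u ?P \<le> ?M * a u u"
  \<comment> \<open>The second case cancels a factor M. If M = 0, then \<open>?P\<close> has energy
    at most 0 and vanishes.\<close>
  proof (cases "?M = 0")
    case True
    then have "?P = 0"
      using PP energy.pos[OF PV] by force
    then show ?thesis
      using energy.zero_right[OF u] True by simp
  next
    case False
    \<comment> \<open>Nonnegative energy of M u - P gives 2 M a(u,P) <= M^2 a(u,u) + a(P,P), and the
      last term is at most M a(u,P).\<close>
    let ?d = "(\<lambda>x. ?M * u x) - ?P"
    have MuV: "(\<lambda>x. ?M * u x) \<in> Vh"
      by (rule energy.scale_in[OF u])
    have "0 \<le> a ?d ?d"
      by (intro energy.nonneg energy.diff_in MuV PV)
    also have "a ?d ?d = ?M * (?M * a u u) - 2 * (?M * a u ?P) + a ?P ?P"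
      unfolding energy.diff_left[OF MuV PV energy.diff_in[OF MuV PV]]
        energy.diff_right[OF MuV PV MuV] energy.diff_right[OF MuV PV PV]
        energy.scale_left[OF u MuV] energy.scale_left[OF u PV] energy.scale_right[OF u u]
        energy.scale_right[OF u PV] energy.sym[OF PV u]
      by simp
    finally have "?M * a u ?P \<le> ?M * (?M * a u u)"
      using PP by simp
    then show ?thesis
      using False by (simp only: mult_le_cancel_left_pos of_nat_0_less_iff of_nat_eq_0_iff neq0_conv)
  qed
  moreover have "a u ?q \<le> a u u"
  proof -
    have "a u ?q = a ?q ?q"
      using proj_coarse_props[OF u] by simp
    moreover have "0 \<le> a (u - ?q) (u - ?q)"
      by (intro energy.nonneg energy.diff_in u qV)
    moreover have "a (u - ?q) (u - ?q) = a u u - 2 * a u ?q + a ?q ?q"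
      unfolding energy.diff_left[OF u qV energy.diff_in[OF u qV]] energy.diff_right[OF u qV u]
        energy.diff_right[OF u qV qV] energy.sym[OF qV u] by simp
    ultimately show ?thesis by simp
  qed
  ultimately show ?thesis
    unfolding B_inv_Ah energy.add_right[OF PV qV u] by (simp add: distrib_right)
qed

lemma lower_bound:
  assumes u: "u \<in> Vh" and "0 < \<sigma>"
    and shape: "\<And>T. T \<in> \<T> \<Longrightarrow> \<exists>p r. ball p r \<subseteq> T \<and> \<sigma> * Max (diameter ` \<T>) \<le> r"
  shows "a u u \<le> (1 + (8 * real overlap_number + 2 * \<Lambda>) / \<sigma>\<^sup>2) * a u (B_inv (Ah u))"
proof -
  \<comment> \<open>On \<open>Vtilde\<close> each local s is at most \<Lambda> times the local
    energy, which turns the bound for the pieces into Q times the energy.\<close>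
  define Q where "Q = (8 * real overlap_number + 2 * \<Lambda>) / \<sigma>\<^sup>2"
  have "0 < Q"
    using threshold \<open>0 < \<sigma>\<close> by (simp add: Q_def add_nonneg_pos)
  interpret Vt: inner_form Vtilde a
    by (rule energy.mono_inner[OF subspace_Vtilde Vtilde_subset])
  have "linear_functional_on Vtilde (a u)"
    by (rule linear_functional_on_subset[OF energy.linear_functional_on_form[OF u] Vtilde_subset])
  then obtain w where w: "w \<in> Vtilde" "\<And>v. v \<in> Vtilde \<Longrightarrow> a w v = a u v"
    using Vt.representation_exists by metis
  have wV: "w \<in> Vh"
    using w(1) Vtilde_subset by blast
  define v where "v = u - w"
  have vV: "v \<in> Vh"
    unfolding v_def by (rule energy.diff_in[OF u wV])
  have v_orth: "a v z = 0" if "z \<in> Vtilde" for z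
    unfolding v_def using energy.diff_left[OF u wV, of z] w(2)[OF that] that Vtilde_subset by auto
  then have vC: "v \<in> Vcoarse"
    by (simp add: Vcoarse_def vV)
  have u_eq: "u = w + v"
    by (simp add: v_def)
  have pyth: "a u u = a w w + a v v"
  proof -
    have "a v w = 0" by (rule v_orth[OF w(1)])
    then have "a (w + v) (w + v) = a w w + a v v"
      unfolding energy.add_left[OF wV vV energy.add_in[OF wV vV]] energy.add_right[OF wV vV wV]
        energy.add_right[OF wV vV vV] energy.sym[OF wV vV] by simp
    then show ?thesis
      using u_eq by simp
  qed
  have "(\<Sum>j=1..N. a (piece j w) (piece j w))
      \<le> (\<Sum>i=1..N. (8 * real overlap_number * a_sub i w w + 2 * s_sub i w w) / \<sigma>\<^sup>2)"
    by (rule pieces_energy[OF wV \<open>0 < \<sigma>\<close> shape])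
  also have "\<dots> \<le> (\<Sum>i=1..N. Q * a_sub i w w)"
  proof (rule sum_mono)
    fix i assume i: "i \<in> {1..N}"
    have "8 * real overlap_number * a_sub i w w + 2 * s_sub i w w
        \<le> (8 * real overlap_number + 2 * \<Lambda>) * a_sub i w w"
      using Vtilde_spectral_bound[OF i w(1)] by (simp add: distrib_right)
    then have "(8 * real overlap_number * a_sub i w w + 2 * s_sub i w w) / \<sigma>\<^sup>2
        \<le> ((8 * real overlap_number + 2 * \<Lambda>) * a_sub i w w) / \<sigma>\<^sup>2"
      by (rule divide_right_mono) simp
    then show "(8 * real overlap_number * a_sub i w w + 2 * s_sub i w w) / \<sigma>\<^sup>2 \<le> Q * a_sub i w w"
      by (simp add: Q_def)
  qed
  also have "\<dots> = Q * a w w"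
    unfolding sum_distrib_left[symmetric] sum_a_sub[OF wV] ..
  finally have pieces: "(\<Sum>j=1..N. a (piece j w) (piece j w)) \<le> Q * a w w" .
  \<comment> \<open>Index 0 is free, as the subdomains start at 1; it carries the coarse component,
    so that a single family enters the abstract lemma.\<close>
  define f where "f j = (if j = 0 then v else piece j w)" for j
  define p where "p j = (if j = 0 then proj_coarse u else proj j u)" for j
  have split: "sum g {0..N} = g 0 + sum g {1..N}" for g :: "nat \<Rightarrow> 'b::comm_monoid_add"
    by (simp add: sum.atLeast_Suc_atMost)
  have f_sum: "sum f {1..N} = w"
  proof -
    have "sum f {1..N} = (\<Sum>j=1..N. piece j w)"
      by (rule sum.cong) (simp_all add: f_def)
    then show ?thesis
      using sum_pieces[OF wV] by (rule trans)
  qed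
  have p_sum: "sum p {0..N} = B_inv (Ah u)"
    unfolding split B_inv_Ah add.commute[of _ "proj_coarse u"]
    by (intro arg_cong2[where f = plus] sum.cong refl) (simp_all add: p_def)
  have fp: "f j \<in> Vh \<and> p j \<in> Vh \<and> a (p j) (f j) = a u (f j) \<and> a (p j) (p j) = a u (p j)"
    if j: "j \<in> {0..N}" for j
  proof (cases "j = 0")
    case True
    then show ?thesis
      using proj_coarse_props[OF u] vV vC Vcoarse_subset by (auto simp: f_def p_def)
  next
    case False
    then have j: "j \<in> {1..N}" using that by simp
    then show ?thesis
      using False proj_props[OF j u] piece_in_Vloc[OF j wV] Vloc_subset by (auto simp: f_def p_def)
  qed
  have "(\<Sum>j\<in>{0..N}. a (f j) (f j)) \<le> (1 + Q) * a u u"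
  proof -
    have "(\<Sum>j\<in>{0..N}. a (f j) (f j)) = a v v + (\<Sum>j=1..N. a (piece j w) (piece j w))"
      unfolding split by (intro arg_cong2[where f = plus] sum.cong refl) (simp_all add: f_def)
    also have "\<dots> \<le> a v v + Q * a w w"
      using pieces by simp
    \<comment> \<open>By orthogonality the energies of w and v add up to that of u.\<close>
    also have "\<dots> \<le> (1 + Q) * a u u"
      unfolding pyth using \<open>0 < Q\<close> energy.nonneg[OF vV] energy.nonneg[OF wV]
      by (simp add: algebra_simps)
    finally show ?thesis .
  qed
  moreover have "u = sum f {0..N}"
    unfolding split f_sum using u_eq by (simp add: f_def add.commute)
  ultimately have "a u u \<le> (1 + Q) * a u (sum p {0..N})"
    using fp \<open>0 < Q\<close> by (intro energy.stable_decomposition_lower_bound[OF u, of "{0..N}" f p]) auto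
  then show ?thesis
    unfolding p_sum Q_def .
qed

lemma eigenvalue_bounds:
  assumes "0 < \<sigma>" "\<mu> \<in> eigenvalues_on Vh (B_inv \<circ> Ah)"
    and shape: "\<And>T. T \<in> \<T> \<Longrightarrow> \<exists>p r. ball p r \<subseteq> T \<and> \<sigma> * Max (diameter ` \<T>) \<le> r"
  shows "\<mu> \<le> real overlap_number + 1"
    and "1 \<le> (1 + (8 * real overlap_number + 2 * \<Lambda>) / \<sigma>\<^sup>2) * \<mu>"
proof -
  obtain u where u: "u \<in> Vh" "u \<noteq> 0" "B_inv (Ah u) = (\<lambda>x. \<mu> * u x)"
    using assms(2) by (auto simp: eigenvalues_on_def)
  have pos: "0 < a u u"
    by (rule energy.pos[OF u(1,2)])
  have eq: "a u (B_inv (Ah u)) = \<mu> * a u u"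
    unfolding u(3) by (rule energy.scale_right[OF u(1,1)])
  show "\<mu> \<le> real overlap_number + 1"
    using upper_bound[OF u(1)] pos unfolding eq by simp
  have "1 * a u u \<le> ((1 + (8 * real overlap_number + 2 * \<Lambda>) / \<sigma>\<^sup>2) * \<mu>) * a u u"
    using lower_bound[OF u(1) assms(1) shape] unfolding eq by (simp add: mult.assoc)
  then show "1 \<le> (1 + (8 * real overlap_number + 2 * \<Lambda>) / \<sigma>\<^sup>2) * \<mu>"
    using pos by (simp only: mult_le_cancel_right_pos)
qed

end

text \<open>The lower hypothesis makes every eigenvalue positive, which excludes the singular case
  and removes the absolute values.\<close>

lemma cond_number_le:
  assumes "0 < K" "0 \<le> R"
    and upper: "\<And>\<mu>. \<mu> \<in> eigenvalues_on V A \<Longrightarrow> \<mu> \<le> R"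
    and lower: "\<And>\<mu>. \<mu> \<in> eigenvalues_on V A \<Longrightarrow> 1 \<le> K * \<mu>"
  shows "cond_number V A \<le> ereal (R * K)"
proof -
  let ?E = "eigenvalues_on V A"
  have no0: "0 \<notin> ?E"
    using lower by force
  show ?thesis
  proof (cases "?E = {}")
    \<comment> \<open>For an empty spectrum the quotient is -\<infinity> / \<infinity>, which is 0
      in \<open>ereal\<close> because \<open>inverse \<infinity> = 0\<close>.\<close>
    case True
    then show ?thesis
      using no0 assms(1,2) by (simp add: cond_number_def bot_ereal_def top_ereal_def divide_ereal_def)
  next
    case False
    then obtain e where e: "e \<in> ?E" by blast
    have low: "1 / K \<le> \<mu>" if "\<mu> \<in> ?E" for \<mu>
      using lower[OF that] \<open>0 < K\<close> by (simp add: field_simps)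
    have abs: "\<bar>\<mu>\<bar> = \<mu>" if "\<mu> \<in> ?E" for \<mu>
      using low[OF that] \<open>0 < K\<close> by (meson abs_of_nonneg divide_nonneg_pos order_trans zero_le_one)
    let ?S = "SUP \<mu>\<in>?E. ereal \<bar>\<mu>\<bar>" and ?I = "INF \<mu>\<in>?E. ereal \<bar>\<mu>\<bar>"
    have "?S \<le> ereal R"
      using upper abs by (intro SUP_least) simp
    moreover have "ereal \<bar>e\<bar> \<le> ?S"
      using e by (rule SUP_upper)
    \<comment> \<open>An eigenvalue e and the bound R enclose the supremum, so it is a real number;
      the infimum is treated likewise, and the division becomes one of reals.\<close>
    ultimately obtain s where s: "?S = ereal s" "s \<le> R"
      by (cases ?S) auto
    have "ereal (1 / K) \<le> ?I"
      using low abs by (intro INF_greatest) simp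
    moreover have "?I \<le> ereal \<bar>e\<bar>"
      using e by (rule INF_lower)
    ultimately obtain t where t: "?I = ereal t" "1 / K \<le> t"
      by (cases ?I) auto
    have "0 < 1 / K"
      using \<open>0 < K\<close> by simp
    then have "s / t \<le> R / (1 / K)"
      using s(2) t(2) \<open>0 \<le> R\<close> by (intro frac_le)
    moreover have "t \<noteq> 0"
      using t(2) \<open>0 < 1 / K\<close> by linarith
    ultimately show ?thesis
      using no0 s(1) t(1) by (simp add: cond_number_def)
  qed
qed

theorem theorem3p1:
  fixes \<F> :: "'a::euclidean_space set set set"
  assumes "quasi_uniform \<F>"
  shows "\<exists>C :: real \<Rightarrow> nat \<Rightarrow> real.
    (\<forall>\<Lambda> M. 0 < C \<Lambda> M) \<and>
    (\<forall>\<Omega> \<rho> \<T> N Osub k ip \<Lambda> ev \<phi> l.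
       \<T> \<in> \<F> \<longrightarrow> two_level_schwarz \<Omega> \<rho> \<T> N Osub k ip \<Lambda> ev \<phi> l \<longrightarrow>
       two_level_schwarz.cond_preconditioned \<Omega> \<rho> \<T> N Osub k ip \<phi> l
         \<le> ereal (C \<Lambda> (overlapping_decomposition.overlap_number \<T> N Osub k)))"
proof -
  \<comment> \<open>This \<sigma> depends on the family alone and precedes mesh, coefficient and
    decomposition, so that \<open>C\<close> can be a function of \<Lambda> and M.\<close>
  obtain \<sigma> where \<sigma>: "0 < \<sigma>"
    "\<And>\<T> T. \<lbrakk>\<T> \<in> \<F>; T \<in> \<T>\<rbrakk> \<Longrightarrow> \<exists>p r. ball p r \<subseteq> T \<and> \<sigma> * Max (diameter ` \<T>) \<le> r"
    using assms unfolding quasi_uniform_def by blast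
  \<comment> \<open>The absolute value keeps the constant positive for every real argument; for a
    threshold above 1 it disappears in \<open>K_eq\<close>.\<close>
  define K where "K \<Lambda> M = 1 + (8 * real M + 2 * \<bar>\<Lambda>\<bar>) / \<sigma>\<^sup>2" for \<Lambda> :: real and M :: nat
  define C where "C \<Lambda> M = (real M + 1) * K \<Lambda> M" for \<Lambda> :: real and M :: nat
  have K_pos: "0 < K \<Lambda> M" for \<Lambda> M
    unfolding K_def by (intro add_pos_nonneg divide_nonneg_nonneg) auto
  then have "0 < C \<Lambda> M" for \<Lambda> M
    unfolding C_def by (intro mult_pos_pos) auto
  moreover have "two_level_schwarz.cond_preconditioned \<Omega> \<rho> \<T> N Osub k ip \<phi> l
      \<le> ereal (C \<Lambda> (overlapping_decomposition.overlap_number \<T> N Osub k))"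
    if "\<T> \<in> \<F>" and S: "two_level_schwarz \<Omega> \<rho> \<T> N Osub k ip \<Lambda> ev \<phi> l"
    for \<Omega> \<rho> \<T> N Osub k ip \<Lambda> ev \<phi> l
  proof -
    interpret two_level_schwarz \<Omega> \<rho> \<T> N Osub k ip \<Lambda> ev \<phi> l
      by (rule S)
    have K_eq: "K \<Lambda> overlap_number = 1 + (8 * real overlap_number + 2 * \<Lambda>) / \<sigma>\<^sup>2"
      using threshold by (simp add: K_def)
    show ?thesis
      unfolding cond_preconditioned_def C_def
    proof (rule cond_number_le[OF K_pos])
      fix \<mu> assume \<mu>: "\<mu> \<in> eigenvalues_on Vh (B_inv \<circ> Ah)"
      show "\<mu> \<le> real overlap_number + 1" "1 \<le> K \<Lambda> overlap_number * \<mu>"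
        using eigenvalue_bounds[OF \<sigma>(1) \<mu> \<sigma>(2)[OF \<open>\<T> \<in> \<F>\<close>]] unfolding K_eq by blast+
    qed simp
  qed
  ultimately show ?thesis
    by (intro exI[of _ C]) blast
qed

end
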